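(* Let $(\overline{x},\overline{v})\in{\rm gph}\,\mathcal{N}_{\Gamma}$. Suppose that the multifunction $\mathcal{G}$ is metrically subregular at $\overline{x}$ for the origin. If $\mathcal{M}_{\overline{x}}$ is isolated calm at $\overline{v}$ for some $\overline{\lambda}\in\mathcal{M}_{\overline{x}}(\overline{v})$, then $$\mathcal{T}_{{\rm gph}\mathcal{N}_{\Gamma}}(\overline{x},\overline{v})\subseteq\Big\{(d,w)\in\mathbb{X}\times\mathbb{X}\ |\ w\in \nabla^2\langle\overline{\lambda},g\rangle(\overline{x})d+\nabla g(\overline{x})D\mathcal{N}_K(g(\overline{x})|\overline{\lambda})(g'(\overline{x})d)\Big\}.$$ If, in addition, the mapping $\Phi$ is metrically subregular at $(\overline{x},\overline{\lambda},\overline{v})$ for the origin, then $$\mathcal{T}_{{\rm gph}\mathcal{N}_{\Gamma}}(\overline{x},\overline{v})=\Big\{(d,w)\in\mathbb{X}\times\mathbb{X}\ |\ w\in \nabla^2\langle\overline{\lambda},g\rangle(\overline{x})d+\nabla g(\overline{x})D\mathcal{N}_K(g(\overline{x})|\overline{\lambda})(g'(\overline{x})d)\Big\}.$$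
   Context: $\mathbb{X},\mathbb{Y}$ are finite-dimensional real inner product spaces; $g:\mathbb{X}\to\mathbb{Y}$ is twice continuously differentiable; $K\subseteq\mathbb{Y}$ is a nonempty closed convex set that is $C^2$-cone reducible, i.e. for every $\overline{y}\in K$ there exist an open neighborhood $\mathcal{Y}$ of $\overline{y}$, a finite-dimensional space $\mathbb{Z}$, a pointed closed convex cone $D\subseteq\mathbb{Z}$ and a twice continuously differentiable $\Xi:\mathcal{Y}\to\mathbb{Z}$ with $\Xi(\overline{y})=0$, $\Xi'(\overline{y})$ onto, and $K\cap\mathcal{Y}=\{y\in\mathcal{Y}\,|\,\Xi(y)\in D\}$. $g'(x)$ is the derivative, $\nabla g(x):\mathbb{Y}\to\mathbb{X}$ is the adjoint of $g'(x)$, and $\nabla^2\langle\lambda,g\rangle(x)$ is the Hessian at $x$ of $\langle\lambda,g(\cdot)\rangle$. $\Gamma:=g^{-1}(K)$; $\mathcal{G}(x):=g(x)-K$; $\mathcal{M}_{x}(v):=\{\lambda\in\mathcal{N}_K(g(x))\,|\,v=\nabla g(x)\lambda\}$ for $x\in\Gamma$, $v\in\mathbb{X}$ (a multifunction $\mathbb{X}\rightrightarrows\mathbb{Y}$); and, with $\Pi_K$ the projection onto $K$, $$\Phi(x,\lambda,v):=\big(-v+\nabla g(x)\lambda,\ g(x)-\Pi_K(g(x)+\lambda)\big),\quad (x,\lambda,v)\in\mathbb{X}\times\mathbb{Y}\times\mathbb{X}.$$ Contingent cone: $\mathcal{T}_\Omega(\overline{z})=\{w\,|\,\exists t_k\downarrow0,\,w^k\to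 w,\ \overline{z}+t_kw^k\in\Omega\}$. Regular normal cone: $\widehat{\mathcal{N}}_\Omega(\overline{z})=\{v\,|\,\limsup_{z\to\overline{z},\,z\in\Omega}\langle v,z-\overline{z}\rangle/\|z-\overline{z}\|\le0\}$ for $\overline{z}\in\Omega$ (empty otherwise); limiting normal cone: $\mathcal{N}_\Omega(\overline{z})=\limsup_{z\to\overline{z},\,z\in\Omega}\widehat{\mathcal{N}}_\Omega(z)$ (outer limit). For the convex set $K$ they coincide; metric subregularity of $\mathcal{G}$ at $\overline{x}$ for $0$ ensures they coincide for $\Gamma$ at points of $\Gamma$ near $\overline{x}$. Graphical derivative of $\mathcal{F}:\mathbb{Z}\rightrightarrows\mathbb{W}$ at $(\overline{z},\overline{w})\in{\rm gph}\mathcal{F}$: $\Delta w\in D\mathcal{F}(\overline{z}|\overline{w})(\Delta z)$ iff $(\Delta z,\Delta w)\in\mathcal{T}_{{\rm gph}\mathcal{F}}(\overline{z},\overline{w})$. $\mathcal{F}$ is metrically subregular at $\overline{z}$ for $\overline{w}\in\mathcal{F}(\overline z)$ if there are $\kappa\ge0$, $\varepsilon,\delta>0$ with ${\rm dist}(z,\mathcal{F}^{-1}(\overline{w}))\le\kappa\,{\rm dist}(\overline{w},\mathcal{F}(z)\cap\mathbb{B}(\overline{w},\delta))$ for all $z\in\mathbb{B}(\overline{z},\varepsilon)$ (distance to the empty set is $+\infty$). $\mathcal{F}$ is isolated calm at $\overline{z}$ for $\overline{w}\in\mathcal{F}(\overline z)$ if there are $\kappa\ge0$, $\varepsilon,\delta>0$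 with $\mathcal{F}(z)\cap\mathbb{B}(\overline{w},\delta)\subseteq\mathcal{F}(\overline{z})+\kappa\|z-\overline{z}\|\mathbb{B}$ for all $z\in\mathbb{B}(\overline{z},\varepsilon)$, and $\mathcal{F}(\overline{z})\cap\mathbb{B}(\overline{w},\delta)=\{\overline{w}\}$. Here $\mathbb{B}(z,r)$ is the closed ball and $\mathbb{B}$ the closed unit ball. *)

theory Defs
  imports "HOL-Analysis.Analysis"
begin

subsection \<open>Smooth maps\<close>

definition twice_cont_diff_on ::
  "'a::euclidean_space set \<Rightarrow> ('a \<Rightarrow> 'b::euclidean_space) \<Rightarrow> bool" where
  "twice_cont_diff_on U f \<longleftrightarrow>
     (\<exists>(f' :: 'a \<Rightarrow> 'a \<Rightarrow>\<^sub>L 'b) (f'' :: 'a \<Rightarrow> 'a \<Rightarrow>\<^sub>L ('a \<Rightarrow>\<^sub>L 'b)).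
        (\<forall>x\<in>U. (f has_derivative blinfun_apply (f' x)) (at x)) \<and>
        (\<forall>x\<in>U. (f' has_derivative blinfun_apply (f'' x)) (at x)) \<and>
        continuous_on U f'')"

definition adj_deriv ::
  "('a::euclidean_space \<Rightarrow> 'b::euclidean_space) \<Rightarrow> 'a \<Rightarrow> 'b \<Rightarrow> 'a" where
  "adj_deriv g x = adjoint (frechet_derivative g (at x))"

definition gradient :: "('a::euclidean_space \<Rightarrow> real) \<Rightarrow> 'a \<Rightarrow> 'a" where
  "gradient f x = (THE D. GDERIV f x :> D)"

text \<open>The Hessian as a linear operator: the derivative of the gradient map.\<close>

definition hessian :: "('a::euclidean_space \<Rightarrow> real) \<Rightarrow> 'a \<Rightarrow> 'a \<Rightarrow> 'a" where
  "hessian f x = frechet_derivative (gradient f) (at x)"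

subsection \<open>Tangent and normal cones\<close>

definition contingent_cone :: "'a::euclidean_space set \<Rightarrow> 'a \<Rightarrow> 'a set" where
  "contingent_cone \<Omega> z =
     {w. \<exists>(t :: nat \<Rightarrow> real) (wk :: nat \<Rightarrow> 'a).
           (\<forall>k. t k > 0) \<and> t \<longlonglongrightarrow> 0 \<and> wk \<longlonglongrightarrow> w \<and> (\<forall>k. z + t k *\<^sub>R wk k \<in> \<Omega>)}"

text \<open>At an isolated point of \<open>\<Omega>\<close> the upper limit is \<open>-\<infinity>\<close>, so every vector is a regular normal.\<close>

definition regular_normal_cone :: "'a::euclidean_space set \<Rightarrow> 'a \<Rightarrow> 'a set" where
  "regular_normal_cone \<Omega> zb =
     {v. zb \<in> \<Omega> \<and>
         Limsup (at zb within \<Omega>) (\<lambda>z. ereal (v \<bullet> (z - zb) / norm (z - zb))) \<le> 0}"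

definition normal_cone :: "'a::euclidean_space set \<Rightarrow> 'a \<Rightarrow> 'a set" where
  "normal_cone \<Omega> zb =
     {v. \<exists>(zk :: nat \<Rightarrow> 'a) (vk :: nat \<Rightarrow> 'a).
           (\<forall>k. zk k \<in> \<Omega>) \<and> zk \<longlonglongrightarrow> zb \<and>
           (\<forall>k. vk k \<in> regular_normal_cone \<Omega> (zk k)) \<and> vk \<longlonglongrightarrow> v}"

subsection \<open>Multifunctions\<close>

definition gph :: "('a \<Rightarrow> 'b set) \<Rightarrow> ('a \<times> 'b) set" where
  "gph F = {(z, w). w \<in> F z}"

definition graphical_derivative ::
  "('a::euclidean_space \<Rightarrow> 'b::euclidean_space set) \<Rightarrow> 'a \<Rightarrow> 'b \<Rightarrow> 'a \<Rightarrow> 'b set" where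
  "graphical_derivative F z w dz = {dw. (dz, dw) \<in> contingent_cone (gph F) (z, w)}"

text \<open>Extended-real distance, with value \<open>\<infinity>\<close> for the empty set (\<open>infdist\<close> would give \<open>0\<close>).\<close>

definition edist :: "'a::metric_space \<Rightarrow> 'a set \<Rightarrow> ereal" where
  "edist z S = (INF y\<in>S. ereal (dist z y))"

definition metrically_subregular ::
  "('a::metric_space \<Rightarrow> 'b::metric_space set) \<Rightarrow> 'a \<Rightarrow> 'b \<Rightarrow> bool" where
  "metrically_subregular F zb wb \<longleftrightarrow>
     wb \<in> F zb \<and>
     (\<exists>\<kappa>\<ge>0. \<exists>\<epsilon>>0. \<exists>\<delta>>0. \<forall>z\<in>cball zb \<epsilon>.
        edist z {u. wb \<in> F u} \<le> ereal \<kappa> * edist wb (F z \<inter> cball wb \<delta>))"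

definition isolated_calm ::
  "('a::real_normed_vector \<Rightarrow> 'b::real_normed_vector set) \<Rightarrow> 'a \<Rightarrow> 'b \<Rightarrow> bool" where
  "isolated_calm F zb wb \<longleftrightarrow>
     wb \<in> F zb \<and>
     (\<exists>\<kappa>\<ge>0. \<exists>\<epsilon>>0. \<exists>\<delta>>0.
        (\<forall>z\<in>cball zb \<epsilon>. F z \<inter> cball wb \<delta> \<subseteq>
           {a + (\<kappa> * norm (z - zb)) *\<^sub>R b | a b. a \<in> F zb \<and> b \<in> cball 0 1}) \<and>
        F zb \<inter> cball wb \<delta> = {wb})"

subsection \<open>Cone reducibility\<close>

text \<open>The reduction space, which may depend on \<open>y\<close>, is represented by a linear subspace \<open>Z\<close>
  of the ambient space. This loses no generality: the derivative of \<open>\<Xi>\<close> at \<open>y\<close> maps onto the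
  reduction space, so the dimension of the latter is at most that of the ambient space, and
  the remaining conditions are invariant under linear isomorphisms of the reduction space.\<close>

definition C2_cone_reducible :: "'b::euclidean_space set \<Rightarrow> bool" where
  "C2_cone_reducible K \<longleftrightarrow>
     (\<forall>y\<in>K. \<exists>(U :: 'b set) (Z :: 'b set) (D :: 'b set) (\<Xi> :: 'b \<Rightarrow> 'b).
        open U \<and> y \<in> U \<and> subspace Z \<and>
        D \<subseteq> Z \<and> closed D \<and> convex_cone D \<and> D \<inter> uminus ` D = {0} \<and>
        \<Xi> ` U \<subseteq> Z \<and> twice_cont_diff_on U \<Xi> \<and>
        \<Xi> y = 0 \<and> range (frechet_derivative \<Xi> (at y)) = Z \<and>
        K \<inter> U = {u\<in>U. \<Xi> u \<in> D})"

subsection \<open>The constraint system \<open>g(x) \<in> K\<close>\<close>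

definition feasible_set :: "('a \<Rightarrow> 'b) \<Rightarrow> 'b set \<Rightarrow> 'a set" where
  "feasible_set g K = g -` K"

definition constraint_map :: "('a \<Rightarrow> 'b::ab_group_add) \<Rightarrow> 'b set \<Rightarrow> 'a \<Rightarrow> 'b set" where
  "constraint_map g K x = {g x - y | y. y \<in> K}"

definition multipliers ::
  "('a::euclidean_space \<Rightarrow> 'b::euclidean_space) \<Rightarrow> 'b set \<Rightarrow> 'a \<Rightarrow> 'a \<Rightarrow> 'b set" where
  "multipliers g K x v = {l \<in> normal_cone K (g x). v = adj_deriv g x l}"

definition kkt_map ::
  "('a::euclidean_space \<Rightarrow> 'b::euclidean_space) \<Rightarrow> 'b set \<Rightarrow> 'a \<times> 'b \<times> 'a \<Rightarrow> 'a \<times> 'b" where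
  "kkt_map g K = (\<lambda>(x, l, v).
     (- v + adj_deriv g x l, g x - closest_point K (g x + l)))"

end

theory Submission
  imports Defs
begin

text \<open>
  Write \<open>\<Gamma>\<close> for the feasible set \<open>{x. g x \<in> K}\<close> and \<open>A\<^sub>x\<close> for the adjoint of the derivative of \<open>g\<close>
  at \<open>x\<close>.

  A tangent \<open>(d, w)\<close> to the graph of the normal cone map of \<open>\<Gamma>\<close> comes from normals
  \<open>v\<^sub>k = vb + t\<^sub>k w\<^sub>k\<close> to \<open>\<Gamma>\<close> at \<open>x\<^sub>k = xb + t\<^sub>k d\<^sub>k\<close>. Subregularity of the constraint map is an error bound
  for \<open>\<Gamma>\<close> by the residual \<open>dist (g x) K\<close>; it gives multipliers \<open>\<lambda>\<^sub>k\<close>, normal to \<open>K\<close> at \<open>g x\<^sub>k\<close>, with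
  \<open>v\<^sub>k = A\<^bsub>x\<^sub>k\<^esub> \<lambda>\<^sub>k\<close> and norms bounded by a multiple of those of the \<open>v\<^sub>k\<close> (\<open>normal_multiplier_bounded\<close>).
  Isolated calmness and convexity of the set of multipliers force that set to be \<open>{lb}\<close>, so a
  subsequence of \<open>\<lambda>\<^sub>k\<close> tends to \<open>lb\<close>. If moreover \<open>\<lambda>\<^sub>k - lb = O(t\<^sub>k)\<close>, then a subsequence of
  \<open>(\<lambda>\<^sub>k - lb) / t\<^sub>k\<close> has a limit \<open>\<eta>\<close>; it lies in the graphical derivative of the normal cone map of \<open>K\<close>,
  and the product rule applied to \<open>A\<^bsub>x\<^sub>k\<^esub> \<lambda>\<^sub>k\<close> turns \<open>w\<close> into the Hessian term plus \<open>A\<^bsub>xb\<^esub> \<eta>\<close>.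

  The linear rate is the heart of the matter (\<open>multiplier_linear_rate\<close>). Isolated calmness speaks only
  of normals to \<open>K\<close> at the fixed point \<open>g xb\<close>, whereas \<open>\<lambda>\<^sub>k\<close> is a normal at \<open>g x\<^sub>k\<close>. Cone reducibility
  bridges the gap: up to a diffeomorphism \<open>K\<close> is a closed convex cone near \<open>g xb\<close>, and every normal to a
  convex cone is also a normal at its apex. Transporting by the diffeomorphism costs an error of order
  \<open>norm (g x\<^sub>k - g xb)\<close>, hence \<open>O(t\<^sub>k)\<close> (\<open>cone_reducible_normal_cone_calm\<close>), and calmness applied to the
  transported normal yields the rate.

  Conversely, let \<open>\<eta>\<close> be the limit of \<open>\<eta>\<^sub>k\<close> with \<open>lb + t\<^sub>k \<eta>\<^sub>k\<close> normal to \<open>K\<close> at \<open>g xb + t\<^sub>k u\<^sub>k\<close> and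
  \<open>u\<^sub>k\<close> tending to the derivative of \<open>g\<close> along \<open>d\<close>. At \<open>(xb + t\<^sub>k d, lb + t\<^sub>k \<eta>\<^sub>k, vb + t\<^sub>k w)\<close> the map
  \<open>\<Phi>\<close> is \<open>o(t\<^sub>k)\<close>, because the projection onto \<open>K\<close> is nonexpansive. Subregularity of \<open>\<Phi>\<close> then
  supplies exact zeros of \<open>\<Phi>\<close> at distance \<open>o(t\<^sub>k)\<close>. Each zero is a feasible point with a normal to
  \<open>\<Gamma>\<close>, so \<open>(d, w)\<close> is tangent (\<open>imp_tangent_to_normal_graph\<close>).
\<close>

section \<open>Adjoints and difference quotients\<close>

lemma inner_adjoint_blinfun:
  fixes A :: "'a::euclidean_space \<Rightarrow>\<^sub>L 'b::euclidean_space"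
  shows "h \<bullet> adjoint (blinfun_apply A) l = blinfun_apply A h \<bullet> l"
  by (simp add: adjoint_works blinfun.bounded_linear_right bounded_linear.linear)

lemma norm_adjoint_blinfun_le:
  fixes A :: "'a::euclidean_space \<Rightarrow>\<^sub>L 'b::euclidean_space"
  shows "norm (adjoint (blinfun_apply A) l) \<le> norm A * norm l"
proof -
  let ?w = "adjoint (blinfun_apply A) l"
  have "norm ?w * norm ?w = blinfun_apply A ?w \<bullet> l"
    using inner_adjoint_blinfun[of ?w A l] by (simp flip: power2_norm_eq_inner add: power2_eq_square)
  also have "\<dots> \<le> norm (blinfun_apply A ?w) * norm l"
    by (rule norm_cauchy_schwarz)
  also have "\<dots> \<le> (norm A * norm ?w) * norm l"
    by (intro mult_right_mono norm_blinfun) auto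
  finally have "norm ?w * norm ?w \<le> norm ?w * (norm A * norm l)"
    by (simp add: mult_ac)
  then show ?thesis
    by (cases "norm ?w = 0") (auto simp: mult_le_cancel_left)
qed

text \<open>Bilinearity makes the product rule and joint continuity available for \<open>A\<^bsub>x\<^esub> \<lambda>\<close>, where both the point
  and the multiplier vary.\<close>

lemma bounded_bilinear_adjoint:
  "bounded_bilinear (\<lambda>(A :: 'a::euclidean_space \<Rightarrow>\<^sub>L 'b::euclidean_space) l.
     adjoint (blinfun_apply A) l)"
proof (rule bounded_bilinear.intro)
  fix A A' :: "'a \<Rightarrow>\<^sub>L 'b" and l l' :: 'b and r :: real
  show "adjoint (blinfun_apply (A + A')) l = adjoint (blinfun_apply A) l + adjoint (blinfun_apply A') l"
    by (subst vector_eq_ldot[symmetric])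
      (simp add: inner_adjoint_blinfun inner_add_left inner_add_right blinfun.add_left)
  show "adjoint (blinfun_apply A) (l + l') = adjoint (blinfun_apply A) l + adjoint (blinfun_apply A) l'"
    by (subst vector_eq_ldot[symmetric])
      (simp add: inner_adjoint_blinfun inner_add_right)
  show "adjoint (blinfun_apply (r *\<^sub>R A)) l = r *\<^sub>R adjoint (blinfun_apply A) l"
    by (subst vector_eq_ldot[symmetric])
      (simp add: inner_adjoint_blinfun blinfun.scaleR_left)
  show "adjoint (blinfun_apply A) (r *\<^sub>R l) = r *\<^sub>R adjoint (blinfun_apply A) l"
    by (subst vector_eq_ldot[symmetric]) (simp add: inner_adjoint_blinfun)
  show "\<exists>K. \<forall>(A :: 'a \<Rightarrow>\<^sub>L 'b) l. norm (adjoint (blinfun_apply A) l) \<le> norm A * norm l * K"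
    by (intro exI[of _ 1]) (simp add: norm_adjoint_blinfun_le)
qed

text \<open>All first-order expansions along sequences with varying directions reduce to this form of
  differentiability.\<close>

lemma difference_quotient_tendsto:
  fixes F :: "'a::real_normed_vector \<Rightarrow> 'b::real_normed_vector"
  assumes der: "(F has_derivative F') (at z)"
    and pos: "\<And>k. t k > 0" and t: "t \<longlonglongrightarrow> 0" and w: "w \<longlonglongrightarrow> w0"
  shows "(\<lambda>k. (F (z + t k *\<^sub>R w k) - F z) /\<^sub>R t k) \<longlonglongrightarrow> F' w0"
proof -
  interpret F': bounded_linear F' by (rule has_derivative_bounded_linear[OF der])
  let ?q = "\<lambda>k. (F (z + t k *\<^sub>R w k) - F z) /\<^sub>R t k"
  obtain M where M: "M > 0" "\<And>k. norm (w k) \<le> M"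
    using convergent_imp_Bseq[OF convergentI[OF w]] by (auto elim: BseqE)
  have tw: "(\<lambda>k. t k *\<^sub>R w k) \<longlonglongrightarrow> 0"
    using tendsto_scaleR[OF t w] by simp
  have "(\<lambda>k. ?q k - F' (w k)) \<longlonglongrightarrow> 0"
  proof (rule LIMSEQ_I)
    fix r :: real assume "r > 0"
    define e where "e = r / (2 * M)"
    have "e > 0" using \<open>r > 0\<close> M by (simp add: e_def)
    then obtain d where d: "d > 0"
      "\<And>y. norm (y - z) < d \<Longrightarrow> norm (F y - F z - F' (y - z)) \<le> e * norm (y - z)"
      using der unfolding has_derivative_at_alt by blast
    obtain N where N: "\<And>k. k \<ge> N \<Longrightarrow> norm (t k *\<^sub>R w k) < d"
      using LIMSEQ_D[OF tw d(1)] by auto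
    have "norm (?q k - F' (w k) - 0) < r" if "k \<ge> N" for k
    proof -
      have "?q k - F' (w k) = (F (z + t k *\<^sub>R w k) - F z - F' (t k *\<^sub>R w k)) /\<^sub>R t k"
        using pos[of k] by (simp add: F'.scaleR scaleR_diff_right)
      then have "norm (?q k - F' (w k)) = norm (F (z + t k *\<^sub>R w k) - F z - F' (t k *\<^sub>R w k)) / t k"
        using pos[of k] by (simp add: divide_inverse mult_ac)
      also have "\<dots> \<le> (e * norm (t k *\<^sub>R w k)) / t k"
        using d(2)[of "z + t k *\<^sub>R w k"] N[OF that] pos[of k] by (intro divide_right_mono) auto
      also have "\<dots> = e * norm (w k)"
        using pos[of k] by simp
      also have "\<dots> \<le> e * M"
        using M \<open>e > 0\<close> by (intro mult_left_mono) auto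
      also have "\<dots> < r"
        using M \<open>r > 0\<close> by (simp add: e_def)
      finally show ?thesis by simp
    qed
    then show "\<exists>N. \<forall>k\<ge>N. norm (?q k - F' (w k) - 0) < r" by blast
  qed
  from tendsto_add[OF this F'.tendsto[OF w]] show ?thesis by simp
qed

section \<open>Normals\<close>

text \<open>Without the quotient, the base point itself needs no exclusion and isolated points no separate
  treatment.\<close>

lemma regular_normal_cone_iff:
  "v \<in> regular_normal_cone \<Omega> z \<longleftrightarrow>
     z \<in> \<Omega> \<and> (\<forall>e>0. \<exists>d>0. \<forall>u\<in>\<Omega>. dist u z < d \<longrightarrow> v \<bullet> (u - z) \<le> e * norm (u - z))"
proof -
  let ?q = "\<lambda>u. v \<bullet> (u - z) / norm (u - z)"
  have "Limsup (at z within \<Omega>) (\<lambda>u. ereal (?q u)) \<le> 0 \<longleftrightarrow>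
      (\<forall>e>0. \<forall>\<^sub>F u in at z within \<Omega>. ?q u < e)"
    (is "?L \<longleftrightarrow> ?R")
  proof
    assume L: ?L
    show ?R
    proof (intro allI impI)
      fix e :: real assume "e > 0"
      then have "ereal e > 0" by simp
      then have "\<forall>\<^sub>F u in at z within \<Omega>. ereal (?q u) < ereal e"
        using L unfolding Limsup_le_iff by blast
      then show "\<forall>\<^sub>F u in at z within \<Omega>. ?q u < e" by simp
    qed
  next
    assume R: ?R
    show ?L
      unfolding Limsup_le_iff
    proof (intro allI impI)
      fix y :: ereal assume "y > 0"
      then show "\<forall>\<^sub>F u in at z within \<Omega>. ereal (?q u) < y"
        using R by (cases y) auto
    qed
  qed
  also have "?R \<longleftrightarrow> (\<forall>e>0. \<exists>d>0. \<forall>u\<in>\<Omega>. dist u z < d \<longrightarrow> v \<bullet> (u - z) \<le> e * norm (u - z))"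
    (is "_ \<longleftrightarrow> ?S")
  proof
    assume R: ?R
    show ?S
    proof (intro allI impI)
      fix e :: real assume "e > 0"
      then obtain d where d: "d > 0" "\<And>u. u \<in> \<Omega> \<Longrightarrow> u \<noteq> z \<Longrightarrow> dist u z < d \<Longrightarrow> ?q u < e"
        using R unfolding eventually_at by metis
      have "v \<bullet> (u - z) \<le> e * norm (u - z)" if "u \<in> \<Omega>" "dist u z < d" for u
      proof (cases "u = z")
        case False
        then show ?thesis using d(2)[OF that(1) False that(2)] by (simp add: divide_less_eq)
      qed simp
      then show "\<exists>d>0. \<forall>u\<in>\<Omega>. dist u z < d \<longrightarrow> v \<bullet> (u - z) \<le> e * norm (u - z)"
        using d(1) by blast
    qed
  next
    assume S: ?S
    show ?R
    proof (intro allI impI)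
      fix e :: real assume "e > 0"
      then obtain d where d: "d > 0"
        "\<And>u. u \<in> \<Omega> \<Longrightarrow> dist u z < d \<Longrightarrow> v \<bullet> (u - z) \<le> e / 2 * norm (u - z)"
        using S half_gt_zero by metis
      have "?q u < e" if u: "u \<in> \<Omega>" "u \<noteq> z" "dist u z < d" for u
      proof -
        have "v \<bullet> (u - z) \<le> e / 2 * norm (u - z)" using d(2) u by blast
        also have "\<dots> < e * norm (u - z)" using \<open>e > 0\<close> u(2) by simp
        finally show ?thesis using u(2) by (simp add: divide_less_eq)
      qed
      then show "\<forall>\<^sub>F u in at z within \<Omega>. ?q u < e"
        unfolding eventually_at using d(1) by blast
    qed
  qed
  finally show ?thesis
    by (simp add: regular_normal_cone_def)
qed

lemma regular_normal_imp_normal: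
  "v \<in> regular_normal_cone \<Omega> z \<Longrightarrow> v \<in> normal_cone \<Omega> z"
  unfolding normal_cone_def mem_Collect_eq
  by (rule exI[of _ "\<lambda>_. z"], rule exI[of _ "\<lambda>_. v"]) (simp add: regular_normal_cone_iff)

text \<open>On a segment from \<open>y\<close> to \<open>z\<close> the quotient in the upper limit is constant, so for convex sets the
  local inequality at \<open>y\<close> is already the global one; the global inequality passes to limits.\<close>

lemma normal_cone_convex:
  fixes K :: "'b::euclidean_space set"
  assumes "closed K" "convex K"
  shows "normal_cone K y = {l. y \<in> K \<and> (\<forall>z\<in>K. l \<bullet> (z - y) \<le> 0)}"
proof (intro equalityI subsetI)
  fix l assume "l \<in> normal_cone K y"
  then obtain yk lk where yk: "\<And>k. yk k \<in> K" "yk \<longlonglongrightarrow> y"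
    and lk: "\<And>k. lk k \<in> regular_normal_cone K (yk k)" "lk \<longlonglongrightarrow> l"
    unfolding normal_cone_def by blast
  have "y \<in> K" using closed_sequentially[OF assms(1)] yk by blast
  moreover have "l \<bullet> (z - y) \<le> 0" if z: "z \<in> K" for z
  proof -
    have "lk k \<bullet> (z - yk k) \<le> 0" for k
    proof (rule ccontr)
      define c where "c = lk k \<bullet> (z - yk k)"
      assume "\<not> lk k \<bullet> (z - yk k) \<le> 0"
      then have c: "c > 0" by (simp add: c_def)
      then have nz: "norm (z - yk k) > 0" by (auto simp: c_def)
      \<comment> \<open>Half of the constant slope along the segment from \<open>yk k\<close> to \<open>z\<close>: small enough to contradict regularity.\<close>
      define e where "e = c / (2 * norm (z - yk k))"
      have "e > 0" using c nz by (simp add: e_def)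
      then obtain d where d: "d > 0"
        "\<And>u. u \<in> K \<Longrightarrow> dist u (yk k) < d \<Longrightarrow> lk k \<bullet> (u - yk k) \<le> e * norm (u - yk k)"
        using lk(1)[of k] unfolding regular_normal_cone_iff by metis
      define s where "s = min 1 (d / (2 * norm (z - yk k)))"
      have s: "0 < s" "s \<le> 1" "s * norm (z - yk k) < d"
        using d(1) nz by (auto simp: s_def min_def field_simps split: if_splits)
      define u where "u = yk k + s *\<^sub>R (z - yk k)"
      have "u = (1 - s) *\<^sub>R yk k + s *\<^sub>R z" by (simp add: u_def algebra_simps)
      then have "u \<in> K"
        using convexD[OF assms(2) yk(1)[of k] z, of "1 - s" s] s by simp
      moreover have "dist u (yk k) < d"
        using s by (simp add: u_def dist_norm)
      ultimately have "lk k \<bullet> (u - yk k) \<le> e * norm (u - yk k)" by (rule d(2))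
      then have "s * c \<le> s * (e * norm (z - yk k))"
        using s by (simp add: u_def c_def mult_ac)
      then have "c \<le> e * norm (z - yk k)" using s(1) by simp
      then show False using c nz by (simp add: e_def)
    qed
    moreover have "(\<lambda>k. lk k \<bullet> (z - yk k)) \<longlonglongrightarrow> l \<bullet> (z - y)"
      by (intro tendsto_intros lk yk)
    ultimately show ?thesis
      by (intro LIMSEQ_le_const2) auto
  qed
  ultimately show "l \<in> {l. y \<in> K \<and> (\<forall>z\<in>K. l \<bullet> (z - y) \<le> 0)}" by blast
next
  fix l assume l: "l \<in> {l. y \<in> K \<and> (\<forall>z\<in>K. l \<bullet> (z - y) \<le> 0)}"
  have "l \<bullet> (u - y) \<le> e * norm (u - y)" if "e > 0" "u \<in> K" for e u
  proof -
    have "l \<bullet> (u - y) \<le> 0" using l that(2) by blast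
    also have "0 \<le> e * norm (u - y)" using that(1) by simp
    finally show ?thesis .
  qed
  then have "\<forall>e>0. \<exists>d>0. \<forall>u\<in>K. dist u y < d \<longrightarrow> l \<bullet> (u - y) \<le> e * norm (u - y)"
    using zero_less_one by blast
  then show "l \<in> normal_cone K y"
    using l by (intro regular_normal_imp_normal) (simp add: regular_normal_cone_iff)
qed

lemma normal_cone_closed_graph:
  fixes K :: "'b::euclidean_space set"
  assumes K: "closed K" "convex K"
    and l: "\<forall>\<^sub>F k in sequentially. l k \<in> normal_cone K (y k)"
    and y: "y \<longlonglongrightarrow> y0" and l0: "l \<longlonglongrightarrow> l0"
  shows "l0 \<in> normal_cone K y0"
proof -
  have "y0 \<in> K"
    by (rule Lim_in_closed_set[OF K(1) _ trivial_limit_sequentially y])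
      (rule eventually_mono[OF l], simp add: normal_cone_convex[OF K])
  moreover have "l0 \<bullet> (z - y0) \<le> 0" if z: "z \<in> K" for z
  proof (rule tendsto_upperbound[OF _ _ trivial_limit_sequentially])
    show "(\<lambda>k. l k \<bullet> (z - y k)) \<longlonglongrightarrow> l0 \<bullet> (z - y0)"
      by (intro tendsto_intros l0 y)
    show "\<forall>\<^sub>F k in sequentially. l k \<bullet> (z - y k) \<le> 0"
      using l by eventually_elim (use z in \<open>simp add: normal_cone_convex[OF K]\<close>)
  qed
  ultimately show ?thesis by (simp add: normal_cone_convex[OF K])
qed

lemma normal_cone_iff_closest_point:
  fixes K :: "'b::euclidean_space set"
  assumes "closed K" "convex K" "K \<noteq> {}"
  shows "l \<in> normal_cone K y \<longleftrightarrow> closest_point K (y + l) = y"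
proof
  assume l: "l \<in> normal_cone K y"
  then have y: "y \<in> K" and le: "\<And>z. z \<in> K \<Longrightarrow> l \<bullet> (z - y) \<le> 0"
    by (auto simp: normal_cone_convex[OF assms(1,2)])
  have "dist (y + l) y \<le> dist (y + l) z" if "z \<in> K" for z
  proof -
    have "l \<bullet> l \<le> l \<bullet> l - 2 * (l \<bullet> (z - y)) + (z - y) \<bullet> (z - y)"
      using le[OF that] inner_ge_zero[of "z - y"] by linarith
    also have "\<dots> = (l - (z - y)) \<bullet> (l - (z - y))"
      by (simp add: inner_diff_left inner_diff_right inner_commute)
    finally have "norm l \<le> norm (l - (z - y))" by (simp add: norm_le)
    then show ?thesis by (simp add: dist_norm algebra_simps)
  qed
  then show "closest_point K (y + l) = y"
    using closest_point_unique[OF assms(2,1) y] by metis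
next
  assume eq: "closest_point K (y + l) = y"
  then have "y \<in> K" using closest_point_in_set[OF assms(1,3), of "y + l"] by simp
  moreover have "l \<bullet> (z - y) \<le> 0" if "z \<in> K" for z
    using closest_point_dot[OF assms(2,1) that, of "y + l"] eq by simp
  ultimately show "l \<in> normal_cone K y" by (simp add: normal_cone_convex[OF assms(1,2)])
qed

section \<open>Multipliers for normals to a constraint set\<close>

text \<open>The part of the chain rule for normals that holds without a constraint qualification.\<close>

lemma adjoint_normal_imp_regular_normal:
  fixes g :: "'a::euclidean_space \<Rightarrow> 'b::euclidean_space" and A :: "'a \<Rightarrow>\<^sub>L 'b"
  assumes der: "(g has_derivative blinfun_apply A) (at x)"
    and K: "closed K" "convex K" and l: "l \<in> normal_cone K (g x)"
  shows "adjoint (blinfun_apply A) l \<in> regular_normal_cone (feasible_set g K) x"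
  unfolding regular_normal_cone_iff
proof (intro conjI allI impI)
  have gx: "g x \<in> K" and le: "\<And>z. z \<in> K \<Longrightarrow> l \<bullet> (z - g x) \<le> 0"
    using l by (auto simp: normal_cone_convex[OF K])
  show "x \<in> feasible_set g K" using gx by (simp add: feasible_set_def)
  fix e :: real assume e: "e > 0"
  define e' where "e' = e / (norm l + 1)"
  have "norm l + 1 > 0" using norm_ge_zero[of l] by linarith
  then have e': "e' > 0" "norm l * e' \<le> e"
    using e by (auto simp: e'_def field_simps)
  obtain d where d: "d > 0"
    "\<And>u. norm (u - x) < d \<Longrightarrow> norm (g u - g x - blinfun_apply A (u - x)) \<le> e' * norm (u - x)"
    using der e'(1) unfolding has_derivative_at_alt by blast
  have "adjoint (blinfun_apply A) l \<bullet> (u - x) \<le> e * norm (u - x)"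
    if u: "u \<in> feasible_set g K" "dist u x < d" for u
  proof -
    let ?r = "g u - g x - blinfun_apply A (u - x)"
    have "adjoint (blinfun_apply A) l \<bullet> (u - x) = l \<bullet> (g u - g x) - l \<bullet> ?r"
      using inner_adjoint_blinfun[of "u - x" A l] by (simp add: inner_diff_right inner_commute)
    also have "\<dots> \<le> 0 + norm l * norm ?r"
      using le[of "g u"] u(1) norm_cauchy_schwarz[of l "- ?r"]
      by (simp add: feasible_set_def norm_minus_commute inner_diff_right)
    also have "\<dots> \<le> norm l * (e' * norm (u - x))"
      using d(2)[of u] u(2) by (simp add: dist_norm mult_left_mono)
    also have "\<dots> \<le> e * norm (u - x)"
      using mult_right_mono[OF e'(2), of "norm (u - x)"] by (simp add: mult_ac)
    finally show ?thesis .
  qed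
  then show "\<exists>d>0. \<forall>u\<in>feasible_set g K. dist u x < d \<longrightarrow>
      adjoint (blinfun_apply A) l \<bullet> (u - x) \<le> e * norm (u - x)"
    using d(1) by blast
qed

text \<open>The support function of the truncated polar cone \<open>normal_cone K y \<inter> cball 0 c\<close> at \<open>w\<close> is \<open>c\<close> times
  the distance of \<open>w\<close> to the tangent cone. The distance is realised by the projection onto the closure of
  the cone of feasible directions, whose residual is a normal, and a feasible direction close to the
  projection satisfies the strict inequality as well.\<close>

lemma feasible_direction_near_polar_bound:
  fixes K :: "'b::euclidean_space set"
  assumes K: "closed K" "convex K" and y: "y \<in> K" and c: "c \<ge> 0"
    and less: "\<And>l. l \<in> normal_cone K y \<Longrightarrow> norm l \<le> c \<Longrightarrow> l \<bullet> w < b"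
  obtains a k where "a \<ge> 0" "k \<in> K" "c * norm (w - a *\<^sub>R (k - y)) < b"
proof -
  define S where "S = {a *\<^sub>R (k - y) | a k. a \<ge> 0 \<and> k \<in> K}"
  have S0: "0 \<in> S" using y unfolding S_def by force
  have S_scale: "r *\<^sub>R s \<in> S" if r: "r \<ge> 0" and s: "s \<in> S" for r s
  proof -
    obtain a k where "s = a *\<^sub>R (k - y)" "a \<ge> 0" "k \<in> K" using s by (auto simp: S_def)
    then have "r *\<^sub>R s = (r * a) *\<^sub>R (k - y)" "r * a \<ge> 0" "k \<in> K" using r by auto
    then show ?thesis unfolding S_def by blast
  qed
  have S_add: "s + s' \<in> S" if s: "s \<in> S" "s' \<in> S" for s s'
  proof -
    obtain a k where 1: "s = a *\<^sub>R (k - y)" "a \<ge> 0" "k \<in> K" using s by (auto simp: S_def)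
    obtain a' k' where 2: "s' = a' *\<^sub>R (k' - y)" "a' \<ge> 0" "k' \<in> K" using s by (auto simp: S_def)
    show ?thesis
    proof (cases "a + a' = 0")
      case True
      then have "a = 0" "a' = 0" using 1 2 by auto
      then show ?thesis using 1 2 S0 by simp
    next
      case False
      then have pos: "a + a' > 0" using 1 2 by auto
      define k'' where "k'' = (a / (a + a')) *\<^sub>R k + (a' / (a + a')) *\<^sub>R k'"
      have "a / (a + a') + a' / (a + a') = 1"
        using pos by (simp flip: add_divide_distrib)
      then have "k'' \<in> K" unfolding k''_def
        using 1 2 by (intro convexD[OF K(2)]) auto
      moreover have "(a + a') *\<^sub>R k'' = a *\<^sub>R k + a' *\<^sub>R k'"
        using pos by (simp add: k''_def scaleR_add_right)
      then have "s + s' = (a + a') *\<^sub>R (k'' - y)"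
        by (simp add: 1(1) 2(1) scaleR_diff_right scaleR_add_left)
      ultimately show ?thesis using pos unfolding S_def by fastforce
    qed
  qed
  have "convex_cone S" unfolding convex_cone_iff using S0 S_add S_scale by blast
  then have conv: "convex (closure S)" by (simp add: convex_cone_def convex_closure)
  have ne: "closure S \<noteq> {}" using S0 closure_subset by blast
  define p where "p = closest_point (closure S) w"
  have p: "p \<in> closure S" unfolding p_def by (rule closest_point_in_set) (use ne in auto)
  have dot: "(w - p) \<bullet> (s - p) \<le> 0" if "s \<in> closure S" for s
    unfolding p_def by (rule closest_point_dot[OF conv closed_closure that])
  have "(w - p) \<bullet> p \<ge> 0"
    using dot[of 0] S0 closure_subset[of S] by (auto simp: inner_diff_right)
  \<comment> \<open>Testing the projection against \<open>0\<close> and \<open>2 p\<close> shows that the residual is orthogonal to \<open>p\<close>.\<close>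
  have "2 *\<^sub>R p \<in> closure S"
  proof -
    have "((*\<^sub>R) 2) ` closure S \<subseteq> closure S"
      unfolding closure_scaleR
      by (intro closure_mono) (use S_scale in auto)
    then show ?thesis using p by blast
  qed
  then have "(w - p) \<bullet> p \<le> 0" using dot[of "2 *\<^sub>R p"] by (simp add: inner_diff_right)
  with \<open>(w - p) \<bullet> p \<ge> 0\<close> have orth: "(w - p) \<bullet> p = 0" by simp
  have "(w - p) \<bullet> (k - y) \<le> 0" if "k \<in> K" for k
  proof -
    have "1 *\<^sub>R (k - y) \<in> S" unfolding S_def using that by fastforce
    then have "k - y \<in> closure S" using closure_subset[of S] by auto
    then show ?thesis using dot[of "k - y"] orth by (simp add: inner_diff_right)
  qed
  then have polar: "r *\<^sub>R (w - p) \<in> normal_cone K y" if "r \<ge> 0" for r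
    using y that by (auto simp: normal_cone_convex[OF K] mult_nonneg_nonpos)
  have "c * norm (w - p) < b"
  proof (cases "w = p")
    case True
    then show ?thesis using less[of 0] polar[of 0] c by simp
  next
    case False
    then have pos: "norm (w - p) > 0" by simp
    define l where "l = (c / norm (w - p)) *\<^sub>R (w - p)"
    have "l \<bullet> w < b"
      unfolding l_def using pos c by (intro less polar) auto
    moreover have "(w - p) \<bullet> w = norm (w - p) ^ 2"
      using orth by (simp add: power2_norm_eq_inner inner_diff_right)
    ultimately show ?thesis using pos by (simp add: l_def power2_eq_square)
  qed
  moreover have "open {s. c * norm (w - s) < b}"
    by (intro open_Collect_less continuous_intros)
  ultimately obtain s where s: "s \<in> S" "c * norm (w - s) < b"
    using p open_Int_closure_eq_empty[of "{s. c * norm (w - s) < b}" S] by blast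
  then show ?thesis using that unfolding S_def by blast
qed

text \<open>The images under the adjoint of \<open>A\<close> of the normals \<open>l\<close> to \<open>K\<close> with \<open>norm l \<le> \<kappa> * norm v\<close> form a
  compact convex set \<open>C\<close>. If \<open>v\<close> were outside, a separating direction \<open>H\<close> would satisfy
  \<open>v \<bullet> H > \<kappa> * norm v * norm (A H - s)\<close> for some feasible direction \<open>s\<close> of \<open>K\<close> at \<open>g x\<close>. The error bound corrects the points \<open>x + \<tau> H\<close> to feasible ones
  at a distance of at most about \<open>\<tau> * \<kappa> * norm (A H - s)\<close>. Along these feasible points \<open>v\<close> grows at a
  positive linear rate, which a regular normal does not permit.\<close>

lemma regular_normal_multiplier:
  fixes g :: "'a::euclidean_space \<Rightarrow> 'b::euclidean_space" and A :: "'a \<Rightarrow>\<^sub>L 'b"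
  assumes der: "(g has_derivative blinfun_apply A) (at x)"
    and K: "closed K" "convex K"
    and \<kappa>: "\<kappa> \<ge> 0" and r: "r > 0"
    and bound: "\<And>z y. dist z x < r \<Longrightarrow> y \<in> K \<Longrightarrow> \<exists>p. g p \<in> K \<and> dist z p \<le> \<kappa> * dist (g z) y"
    and v: "v \<in> regular_normal_cone (feasible_set g K) x"
  shows "\<exists>l\<in>normal_cone K (g x). v = adjoint (blinfun_apply A) l \<and> norm l \<le> \<kappa> * norm v"
proof (rule ccontr)
  assume contr: "\<not> ?thesis"
  have gx: "g x \<in> K" using v by (simp add: regular_normal_cone_iff feasible_set_def)
  define N where "N = normal_cone K (g x) \<inter> cball 0 (\<kappa> * norm v)"
  have N_eq: "normal_cone K (g x) = (\<Inter>z\<in>K. {l. (z - g x) \<bullet> l \<le> 0})"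
    using gx by (auto simp: normal_cone_convex[OF K] inner_commute)
  have N: "convex N" "compact N"
    unfolding N_def N_eq
    by (auto intro!: convex_Int convex_INT convex_halfspace_le closed_Int_compact closed_INT
      closed_halfspace_le)
  have lin: "bounded_linear (\<lambda>l. adjoint (blinfun_apply A) l)"
    by (rule bounded_bilinear.bounded_linear_right[OF bounded_bilinear_adjoint])
  define C where "C = (\<lambda>l. adjoint (blinfun_apply A) l) ` N"
  have C: "convex C" "closed C" "v \<notin> C"
    using N contr lin unfolding C_def
    by (auto intro!: convex_linear_image bounded_linear.linear compact_imp_closed
      compact_continuous_image linear_continuous_on simp: N_def)
  obtain h b where hb: "h \<bullet> v < b" "\<forall>z\<in>C. h \<bullet> z > b"
    using separating_hyperplane_closed_point[OF C] by blast
  define H where "H = - h"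
  have vH: "v \<bullet> H > - b" using hb(1) by (simp add: H_def inner_commute)
  have "l \<bullet> blinfun_apply A H < - b" if "l \<in> normal_cone K (g x)" "norm l \<le> \<kappa> * norm v" for l
  proof -
    have "adjoint (blinfun_apply A) l \<in> C" using that by (simp add: C_def N_def)
    then have "h \<bullet> adjoint (blinfun_apply A) l > b" using hb(2) by blast
    then show ?thesis
      by (simp add: inner_adjoint_blinfun H_def blinfun.minus_right inner_commute)
  qed
  then obtain a k where ak: "a \<ge> 0" "k \<in> K"
      "(\<kappa> * norm v) * norm (blinfun_apply A H - a *\<^sub>R (k - g x)) < - b"
    using feasible_direction_near_polar_bound[OF K gx, of "\<kappa> * norm v" "blinfun_apply A H" "- b"] \<kappa>
    by (metis mult_nonneg_nonneg norm_ge_zero)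
  define s where "s = a *\<^sub>R (k - g x)"
  define m where "m = v \<bullet> H - (\<kappa> * norm v) * norm (blinfun_apply A H - s)"
  have m: "m > 0" using vH ak(3) by (simp add: m_def s_def)
  define \<tau> where "\<tau> = (\<lambda>n. inverse (real (Suc n)))"
  have \<tau>: "\<And>n. \<tau> n > 0" "\<tau> \<longlonglongrightarrow> 0"
    unfolding \<tau>_def using LIMSEQ_inverse_real_of_nat by auto
  define G where "G = (\<lambda>n. (g (x + \<tau> n *\<^sub>R H) - g x) /\<^sub>R \<tau> n)"
  have G: "G \<longlonglongrightarrow> blinfun_apply A H"
    unfolding G_def by (rule difference_quotient_tendsto[OF der \<tau> tendsto_const])
  have lim0: "(\<lambda>n. \<tau> n *\<^sub>R H) \<longlonglongrightarrow> 0" "(\<lambda>n. \<tau> n * a) \<longlonglongrightarrow> 0"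
    using tendsto_scaleR[OF \<tau>(2) tendsto_const[of H]] tendsto_mult[OF \<tau>(2) tendsto_const[of a]]
    by auto
  have ev: "\<forall>\<^sub>F n in sequentially. norm (\<tau> n *\<^sub>R H) < r \<and> \<tau> n * a < 1"
    using eventually_conj[OF tendstoD[OF lim0(1) r] order_tendstoD(2)[OF lim0(2) zero_less_one]]
    by simp
  \<comment> \<open>In the limit \<open>v\<close> grows at least at rate \<open>m\<close> along correction points whose distance to \<open>x\<close> grows at
    most at rate \<open>norm H + \<kappa> * norm (A H - s)\<close>; a tolerance below the quotient of the two is refuted.\<close>
  define e where "e = m / (2 * (norm H + \<kappa> * norm (blinfun_apply A H - s) + 1))"
  have den: "norm H + \<kappa> * norm (blinfun_apply A H - s) + 1 > 0"
    using \<kappa> by (simp add: add_nonneg_pos)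
  have e: "e > 0" using m den by (simp add: e_def)
  obtain d where d: "d > 0" "\<And>u. g u \<in> K \<Longrightarrow> dist u x < d \<Longrightarrow> v \<bullet> (u - x) \<le> e * norm (u - x)"
    using v e unfolding regular_normal_cone_iff feasible_set_def by (metis vimageI)
  define D where "D = (\<lambda>n. \<kappa> * norm (G n - s))"
  have D: "D \<longlonglongrightarrow> \<kappa> * norm (blinfun_apply A H - s)"
    unfolding D_def by (intro tendsto_intros G)
  have "(\<lambda>n. \<tau> n * (norm H + D n)) \<longlonglongrightarrow> 0 * (norm H + \<kappa> * norm (blinfun_apply A H - s))"
    by (intro tendsto_intros \<tau> D)
  then have "\<forall>\<^sub>F n in sequentially. \<tau> n * (norm H + D n) < d"
    using order_tendstoD(2) d(1) by simp
  with ev have "\<forall>\<^sub>F n in sequentially. v \<bullet> H - norm v * D n \<le> e * (norm H + D n)"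
  proof eventually_elim
    case (elim n)
    have "g x + \<tau> n *\<^sub>R s = (1 - \<tau> n * a) *\<^sub>R g x + (\<tau> n * a) *\<^sub>R k"
      by (simp add: s_def algebra_simps)
    moreover have "(1 - \<tau> n * a) *\<^sub>R g x + (\<tau> n * a) *\<^sub>R k \<in> K"
      using elim ak \<tau>(1)[of n] gx by (intro convexD[OF K(2)]) auto
    ultimately have "g x + \<tau> n *\<^sub>R s \<in> K" by simp
    then obtain p where p: "g p \<in> K"
        "dist (x + \<tau> n *\<^sub>R H) p \<le> \<kappa> * dist (g (x + \<tau> n *\<^sub>R H)) (g x + \<tau> n *\<^sub>R s)"
      using bound[of "x + \<tau> n *\<^sub>R H"] elim by (auto simp: dist_norm)
    have "g (x + \<tau> n *\<^sub>R H) - (g x + \<tau> n *\<^sub>R s) = \<tau> n *\<^sub>R (G n - s)"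
      using \<tau>(1)[of n] by (simp add: G_def scaleR_diff_right)
    then have "dist (g (x + \<tau> n *\<^sub>R H)) (g x + \<tau> n *\<^sub>R s) = \<tau> n * norm (G n - s)"
      using \<tau>(1)[of n] by (simp add: dist_norm)
    then have near: "norm (p - (x + \<tau> n *\<^sub>R H)) \<le> \<tau> n * D n"
      using p(2) by (simp add: D_def dist_norm norm_minus_commute mult_ac)
    have px: "p - x = \<tau> n *\<^sub>R H + (p - (x + \<tau> n *\<^sub>R H))" by simp
    have "norm (p - x) \<le> norm (\<tau> n *\<^sub>R H) + norm (p - (x + \<tau> n *\<^sub>R H))"
      by (subst px) (rule norm_triangle_ineq)
    also have "\<dots> \<le> \<tau> n * (norm H + D n)"
      using near \<tau>(1)[of n] by (simp add: distrib_left)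
    finally have small: "norm (p - x) \<le> \<tau> n * (norm H + D n)" .
    then have "v \<bullet> (p - x) \<le> e * norm (p - x)"
      using d(2)[OF p(1)] elim by (simp add: dist_norm)
    also have "\<dots> \<le> e * (\<tau> n * (norm H + D n))"
      using small e by (intro mult_left_mono) auto
    finally have 1: "v \<bullet> (p - x) \<le> e * (\<tau> n * (norm H + D n))" .
    have "- (v \<bullet> (p - (x + \<tau> n *\<^sub>R H))) \<le> norm v * norm (p - (x + \<tau> n *\<^sub>R H))"
      using norm_cauchy_schwarz[of "- v" "p - (x + \<tau> n *\<^sub>R H)"] by simp
    also have "\<dots> \<le> norm v * (\<tau> n * D n)"
      using near by (intro mult_left_mono) auto
    finally have "- (v \<bullet> (p - (x + \<tau> n *\<^sub>R H))) \<le> norm v * (\<tau> n * D n)" .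
    moreover have "v \<bullet> (p - x) = \<tau> n * (v \<bullet> H) + v \<bullet> (p - (x + \<tau> n *\<^sub>R H))"
      by (simp add: inner_add_right inner_diff_right)
    ultimately have "\<tau> n * (v \<bullet> H) - norm v * (\<tau> n * D n) \<le> v \<bullet> (p - x)"
      by linarith
    with 1 have "\<tau> n * (v \<bullet> H - norm v * D n) \<le> \<tau> n * (e * (norm H + D n))"
      by (simp add: algebra_simps)
    then show ?case using \<tau>(1)[of n] by simp
  qed
  moreover have "(\<lambda>n. v \<bullet> H - norm v * D n) \<longlonglongrightarrow> v \<bullet> H - norm v * (\<kappa> * norm (blinfun_apply A H - s))"
    and "(\<lambda>n. e * (norm H + D n)) \<longlonglongrightarrow> e * (norm H + \<kappa> * norm (blinfun_apply A H - s))"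
    by (intro tendsto_intros D)+
  ultimately have "v \<bullet> H - norm v * (\<kappa> * norm (blinfun_apply A H - s))
      \<le> e * (norm H + \<kappa> * norm (blinfun_apply A H - s))"
    by (intro tendsto_le[OF trivial_limit_sequentially])
  then have "m \<le> e * (norm H + \<kappa> * norm (blinfun_apply A H - s))"
    by (simp add: m_def mult_ac)
  also have "\<dots> < e * (2 * (norm H + \<kappa> * norm (blinfun_apply A H - s) + 1))"
    using e den by (intro mult_strict_left_mono) auto
  also have "\<dots> = m" using den by (simp add: e_def)
  finally show False by simp
qed

section \<open>Normals to a cone reducible set\<close>

text \<open>With a right inverse \<open>B\<close> of the derivative \<open>A\<close> of \<open>\<Xi>\<close> at \<open>y\<close>, the map
  \<open>F u = (u - y) + B (\<Xi> u - A (u - y))\<close> has derivative the identity at \<open>y\<close> and satisfies \<open>A \<circ> F = \<Xi>\<close>. Thus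
  \<open>F\<close> carries \<open>K\<close> locally to the cone \<open>A -` D\<close>, and the inverse function theorem applies to it, although
  \<open>\<Xi>\<close> itself may lower the dimension.\<close>

lemma C2_cone_reducible_straightening:
  fixes K :: "'b::euclidean_space set"
  assumes "C2_cone_reducible K" "y \<in> K"
  obtains U C and F :: "'b \<Rightarrow> 'b" and F' :: "'b \<Rightarrow> 'b \<Rightarrow>\<^sub>L 'b"
    and F'' :: "'b \<Rightarrow> 'b \<Rightarrow>\<^sub>L ('b \<Rightarrow>\<^sub>L 'b)"
  where "open U" "y \<in> U" "closed C" "convex_cone C"
    "\<And>u. u \<in> U \<Longrightarrow> (F has_derivative blinfun_apply (F' u)) (at u)"
    "\<And>u. u \<in> U \<Longrightarrow> (F' has_derivative blinfun_apply (F'' u)) (at u)"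
    "F y = 0" "F' y = id_blinfun" "\<And>u. u \<in> U \<Longrightarrow> u \<in> K \<longleftrightarrow> F u \<in> C"
proof -
  obtain U Z D and \<Xi> :: "'b \<Rightarrow> 'b" where U: "open U" "y \<in> U" and Z: "subspace Z"
    and D: "D \<subseteq> Z" "closed D" "convex_cone D" and \<Xi>: "\<Xi> ` U \<subseteq> Z" "twice_cont_diff_on U \<Xi>" "\<Xi> y = 0"
    and onto: "range (frechet_derivative \<Xi> (at y)) = Z"
    and KU: "K \<inter> U = {u\<in>U. \<Xi> u \<in> D}"
    using assms unfolding C2_cone_reducible_def by meson
  obtain X' and X'' :: "'b \<Rightarrow> 'b \<Rightarrow>\<^sub>L ('b \<Rightarrow>\<^sub>L 'b)"
    where X': "\<And>u. u \<in> U \<Longrightarrow> (\<Xi> has_derivative blinfun_apply (X' u)) (at u)"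
      and X'': "\<And>u. u \<in> U \<Longrightarrow> (X' has_derivative blinfun_apply (X'' u)) (at u)"
    using \<Xi>(2) unfolding twice_cont_diff_on_def by blast
  define A where "A = X' y"
  have A: "frechet_derivative \<Xi> (at y) = blinfun_apply A"
    using frechet_derivative_at[OF X'[OF U(2)]] by (simp add: A_def)
  have linA: "linear (blinfun_apply A)"
    by (simp add: blinfun.bounded_linear_right bounded_linear.linear)
  obtain R where R: "linear R" "\<And>z. z \<in> Z \<Longrightarrow> blinfun_apply A (R z) = z"
    using linear_exists_right_inverse_on[OF linA subspace_UNIV] onto unfolding A by auto
  define B where "B = Blinfun R"
  have B: "blinfun_apply B = R"
    unfolding B_def using R(1) by (simp add: bounded_linear_Blinfun_apply linear_conv_bounded_linear)
  define F where "F = (\<lambda>u. (u - y) + blinfun_apply B (\<Xi> u - blinfun_apply A (u - y)))"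
  define F' where "F' = (\<lambda>u. id_blinfun + (B o\<^sub>L (X' u - A)))"
  define P where "P = Blinfun (\<lambda>T :: 'b \<Rightarrow>\<^sub>L 'b. B o\<^sub>L T)"
  have P: "blinfun_apply P = (\<lambda>T. B o\<^sub>L T)"
    unfolding P_def
    by (simp add: bounded_linear_Blinfun_apply
        bounded_bilinear.bounded_linear_right[OF bounded_bilinear_blinfun_compose])
  define F'' where "F'' = (\<lambda>u. P o\<^sub>L X'' u)"
  have inZ: "\<Xi> u \<in> Z" if "u \<in> U" for u using \<Xi>(1) that by blast
  have AZ: "blinfun_apply A h \<in> Z" for h using onto unfolding A by blast
  have AF: "blinfun_apply A (F u) = \<Xi> u" if "u \<in> U" for u
  proof -
    have "\<Xi> u - blinfun_apply A (u - y) \<in> Z"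
      using Z inZ[OF that] AZ by (rule subspace_diff)
    then show ?thesis
      by (simp add: F_def blinfun.add_right B R(2))
  qed
  define C where "C = blinfun_apply A -` D"
  show ?thesis
  proof
    show "open U" "y \<in> U" by fact+
    show "closed C" unfolding C_def
      by (intro closed_vimage D) (auto intro: continuous_intros)
    show "convex_cone C" unfolding C_def
      using D(3) by (auto simp: convex_cone_iff blinfun.add_right blinfun.scaleR_right)
    show "(F has_derivative blinfun_apply (F' u)) (at u)" if "u \<in> U" for u
    proof -
      have "(F has_derivative (\<lambda>h. (h - 0) +
          blinfun_apply B (blinfun_apply (X' u) h - blinfun_apply A (h - 0)))) (at u)"
        unfolding F_def
        by (intro has_derivative_add has_derivative_diff has_derivative_ident has_derivative_const
          bounded_linear.has_derivative[OF blinfun.bounded_linear_right] X'[OF that])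
      moreover have "(\<lambda>h. (h - 0) + blinfun_apply B (blinfun_apply (X' u) h - blinfun_apply A (h - 0)))
          = blinfun_apply (F' u)"
        by (simp add: F'_def blinfun.add_left blinfun.diff_left fun_eq_iff)
      ultimately show ?thesis by simp
    qed
    show "(F' has_derivative blinfun_apply (F'' u)) (at u)" if "u \<in> U" for u
    proof -
      have "(\<lambda>w. id_blinfun + blinfun_apply P (X' w - A)) = F'"
        by (simp add: F'_def P)
      moreover have "((\<lambda>w. id_blinfun + blinfun_apply P (X' w - A)) has_derivative
          (\<lambda>h. blinfun_apply P (blinfun_apply (X'' u) h))) (at u)"
        by (auto intro!: derivative_eq_intros X''[OF that]
          bounded_linear.has_derivative[OF blinfun.bounded_linear_right])
      ultimately show ?thesis by (simp add: F''_def blinfun_compose.rep_eq o_def)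
    qed
    show "F y = 0" using \<Xi>(3) by (simp add: F_def blinfun.zero_right)
    show "F' y = id_blinfun" by (simp add: F'_def A_def blinfun_compose_zero)
    show "u \<in> K \<longleftrightarrow> F u \<in> C" if "u \<in> U" for u
      using KU that AF[OF that] by (auto simp: C_def)
  qed
qed

text \<open>Every direction \<open>z - y\<close> with \<open>z \<in> K\<close> is the limit of the difference quotients of \<open>F\<close> along the
  segment from \<open>y\<close> to \<open>z\<close>, and these quotients lie in the closed cone \<open>C\<close>.\<close>

lemma polar_subset_normal_cone:
  fixes K :: "'b::euclidean_space set"
  assumes K: "closed K" "convex K" and y: "y \<in> K" and U: "open U" "y \<in> U"
    and C: "closed C" "convex_cone C" and F: "(F has_derivative id) (at y)" "F y = 0"
    and KC: "\<And>u. u \<in> U \<Longrightarrow> u \<in> K \<longleftrightarrow> F u \<in> C"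
    and polar: "\<And>c. c \<in> C \<Longrightarrow> l \<bullet> c \<le> 0"
  shows "l \<in> normal_cone K y"
proof -
  have "l \<bullet> (z - y) \<le> 0" if z: "z \<in> K" for z
  proof (rule polar)
    define \<tau> where "\<tau> = (\<lambda>n. inverse (real (Suc n)))"
    have \<tau>: "\<And>n. \<tau> n > 0" "\<And>n. \<tau> n \<le> 1" "\<tau> \<longlonglongrightarrow> 0"
      unfolding \<tau>_def using LIMSEQ_inverse_real_of_nat by (auto simp: field_simps)
    have lim: "(\<lambda>n. (F (y + \<tau> n *\<^sub>R (z - y)) - F y) /\<^sub>R \<tau> n) \<longlonglongrightarrow> id (z - y)"
      by (rule difference_quotient_tendsto[OF F(1) \<tau>(1,3) tendsto_const])
    have "(\<lambda>n. y + \<tau> n *\<^sub>R (z - y)) \<longlonglongrightarrow> y + 0 *\<^sub>R (z - y)"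
      by (intro tendsto_intros \<tau>)
    then have "\<forall>\<^sub>F n in sequentially. y + \<tau> n *\<^sub>R (z - y) \<in> U"
      using topological_tendstoD U by fastforce
    then have "\<forall>\<^sub>F n in sequentially. (F (y + \<tau> n *\<^sub>R (z - y)) - F y) /\<^sub>R \<tau> n \<in> C"
    proof eventually_elim
      case (elim n)
      have "y + \<tau> n *\<^sub>R (z - y) = (1 - \<tau> n) *\<^sub>R y + \<tau> n *\<^sub>R z"
        by (simp add: algebra_simps)
      also have "\<dots> \<in> K"
        using \<tau>(1)[of n] \<tau>(2)[of n] y z by (intro convexD[OF K(2)]) auto
      finally have "F (y + \<tau> n *\<^sub>R (z - y)) \<in> C" using KC[OF elim] by simp
      then show ?case
        using \<tau>(1)[of n] F(2) by (simp add: convex_cone_scaleR[OF C(2)])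
    qed
    then show "z - y \<in> C"
      using Lim_in_closed_set[OF C(1) _ trivial_limit_sequentially lim] by simp
  qed
  then show ?thesis using y by (simp add: normal_cone_convex[OF K])
qed

text \<open>Let \<open>F\<close> straighten \<open>K\<close> to the cone \<open>C\<close>. For \<open>c \<in> C\<close> the point \<open>F u + \<tau> c\<close> stays in \<open>C\<close>, so its
  preimage stays in \<open>K\<close>. Hence a normal \<open>l\<close> at \<open>u\<close>, composed with the inverse of \<open>F' u\<close>, is polar to
  \<open>C\<close>, and so it is a normal at \<open>y\<close>. Since \<open>F'\<close> is Lipschitz at \<open>y\<close> with \<open>F' y\<close> the identity, the
  composition changes \<open>l\<close> only by a multiple of \<open>dist u y * norm l\<close>.\<close>

lemma cone_reducible_normal_cone_calm:
  fixes K :: "'b::euclidean_space set"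
  assumes K: "closed K" "convex K" and red: "C2_cone_reducible K" and y: "y \<in> K"
  obtains L r where "L \<ge> 0" "r > 0"
    "\<And>u l. dist u y < r \<Longrightarrow> l \<in> normal_cone K u \<Longrightarrow>
       \<exists>l'\<in>normal_cone K y. norm (l' - l) \<le> L * dist u y * norm l"
proof -
  obtain U C and F :: "'b \<Rightarrow> 'b" and F' :: "'b \<Rightarrow> 'b \<Rightarrow>\<^sub>L 'b"
    and F'' :: "'b \<Rightarrow> 'b \<Rightarrow>\<^sub>L ('b \<Rightarrow>\<^sub>L 'b)"
    where U: "open U" "y \<in> U" and C: "closed C" "convex_cone C"
    and F: "\<And>u. u \<in> U \<Longrightarrow> (F has_derivative blinfun_apply (F' u)) (at u)"
    and F': "\<And>u. u \<in> U \<Longrightarrow> (F' has_derivative blinfun_apply (F'' u)) (at u)"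
    and Fy: "F y = 0" "F' y = id_blinfun" and KC: "\<And>u. u \<in> U \<Longrightarrow> u \<in> K \<longleftrightarrow> F u \<in> C"
    using C2_cone_reducible_straightening[OF red y] by metis
  have contF': "continuous_on U F'"
    by (intro continuous_at_imp_continuous_on ballI has_derivative_continuous[OF F'])
  obtain U' V G G' where U': "open U'" "U' \<subseteq> U" "y \<in> U'" and V: "open V"
    and hom: "homeomorphism U' V F G"
    and G: "\<And>w. w \<in> V \<Longrightarrow> (G has_derivative G' w) (at w)"
    and G': "\<And>w. w \<in> V \<Longrightarrow> G' w = inv (blinfun_apply (F' (G w)))"
    and bij: "\<And>w. w \<in> V \<Longrightarrow> bij (blinfun_apply (F' (G w)))"
    by (rule inverse_function_theorem[OF U(1) F contF' U(2), of id_blinfun])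
      (auto simp: Fy(2) blinfun_eqI)
  define M where "M = norm (F'' y) + 1"
  have M: "M > 0" by (simp add: M_def add_nonneg_pos)
  obtain d1 where d1: "d1 > 0"
    "\<And>u. norm (u - y) < d1 \<Longrightarrow> norm (F' u - F' y - blinfun_apply (F'' y) (u - y)) \<le> 1 * norm (u - y)"
    using F'[OF U(2)] unfolding has_derivative_at_alt by (metis zero_less_one)
  have lip: "norm (F' u - id_blinfun) \<le> M * dist u y" if "dist u y < d1" for u
  proof -
    have "F' u - id_blinfun = (F' u - F' y - blinfun_apply (F'' y) (u - y)) + blinfun_apply (F'' y) (u - y)"
      by (simp add: Fy)
    also have "norm \<dots> \<le> 1 * norm (u - y) + norm (F'' y) * norm (u - y)"
      using d1(2)[of u] that by (intro norm_triangle_mono norm_blinfun) (auto simp: dist_norm)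
    finally show ?thesis by (simp add: M_def dist_norm algebra_simps)
  qed
  obtain d2 where d2: "d2 > 0" "ball y d2 \<subseteq> U'"
    using U' open_contains_ball by blast
  define r where "r = min (min d1 d2) (1 / (2 * M))"
  have r: "r > 0" "r \<le> d1" "r \<le> d2" "r \<le> 1 / (2 * M)"
    using d1(1) d2(1) M by (auto simp: r_def)
  have "\<exists>l'\<in>normal_cone K y. norm (l' - l) \<le> 2 * M * dist u y * norm l"
    if u: "dist u y < r" and l: "l \<in> normal_cone K u" for u l
  proof -
    have uK: "u \<in> K" and lK: "\<And>z. z \<in> K \<Longrightarrow> l \<bullet> (z - u) \<le> 0"
      using l by (auto simp: normal_cone_convex[OF K])
    have uU': "u \<in> U'" using u r d2(2) by (auto simp: dist_commute)
    then have FuV: "F u \<in> V" and GFu: "G (F u) = u"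
      using hom by (auto simp: homeomorphism_def)
    define S where "S = Blinfun (G' (F u))"
    have bl: "bounded_linear (G' (F u))"
      by (rule has_derivative_bounded_linear[OF G[OF FuV]])
    have S: "blinfun_apply S = G' (F u)"
      unfolding S_def using bl by (rule bounded_linear_Blinfun_apply)
    have SF: "blinfun_apply S (blinfun_apply (F' u) h) = h" for h
      using bij[OF FuV] unfolding S G'[OF FuV] GFu by (simp add: bij_is_inj)
    define l' where "l' = adjoint (blinfun_apply S) l"
    have l'_inner: "l' \<bullet> c = l \<bullet> blinfun_apply S c" for c
      unfolding l'_def using inner_adjoint_blinfun[of c S l] by (simp add: inner_commute)
    have "l' \<bullet> c \<le> 0" if c: "c \<in> C" for c
    proof -
      define \<tau> where "\<tau> = (\<lambda>n. inverse (real (Suc n)))"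
      have \<tau>: "\<And>n. \<tau> n > 0" "\<tau> \<longlonglongrightarrow> 0"
        unfolding \<tau>_def using LIMSEQ_inverse_real_of_nat by auto
      have lim: "(\<lambda>n. (G (F u + \<tau> n *\<^sub>R c) - G (F u)) /\<^sub>R \<tau> n) \<longlonglongrightarrow> blinfun_apply S c"
        unfolding S by (rule difference_quotient_tendsto[OF G[OF FuV] \<tau> tendsto_const])
      have "(\<lambda>n. F u + \<tau> n *\<^sub>R c) \<longlonglongrightarrow> F u + 0 *\<^sub>R c"
        by (intro tendsto_intros \<tau>)
      then have "\<forall>\<^sub>F n in sequentially. F u + \<tau> n *\<^sub>R c \<in> V"
        using topological_tendstoD V FuV by fastforce
      then have "\<forall>\<^sub>F n in sequentially. l \<bullet> ((G (F u + \<tau> n *\<^sub>R c) - G (F u)) /\<^sub>R \<tau> n) \<le> 0"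
      proof eventually_elim
        case (elim n)
        have "F u \<in> C" using KC uU' U' uK by blast
        then have "F u + \<tau> n *\<^sub>R c \<in> C"
          using \<tau>(1)[of n] c by (intro convex_cone_add[OF C(2)] convex_cone_scaleR[OF C(2)]) auto
        moreover have "F (G (F u + \<tau> n *\<^sub>R c)) = F u + \<tau> n *\<^sub>R c" "G (F u + \<tau> n *\<^sub>R c) \<in> U'"
          using hom elim by (auto simp: homeomorphism_def)
        ultimately have "G (F u + \<tau> n *\<^sub>R c) \<in> K" using KC U' by auto
        from lK[OF this] show ?case
          using \<tau>(1)[of n] by (simp add: GFu mult_nonneg_nonpos)
      qed
      moreover have "(\<lambda>n. l \<bullet> ((G (F u + \<tau> n *\<^sub>R c) - G (F u)) /\<^sub>R \<tau> n)) \<longlonglongrightarrow> l \<bullet> blinfun_apply S c"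
        by (intro tendsto_intros lim)
      ultimately show ?thesis
        unfolding l'_inner by (intro tendsto_upperbound[OF _ _ trivial_limit_sequentially])
    qed
    then have "l' \<in> normal_cone K y"
      using polar_subset_normal_cone[OF K y U C _ Fy(1) KC, of l'] F[OF U(2)]
      by (simp add: Fy(2) id_def)
    moreover have "norm (l' - l) \<le> 2 * M * dist u y * norm l"
    proof -
      have l_eq: "l = adjoint (blinfun_apply (F' u)) l'"
        by (subst vector_eq_ldot[symmetric])
          (metis SF inner_adjoint_blinfun inner_commute l'_inner)
      have id_eq: "adjoint (blinfun_apply id_blinfun) l' = l'"
        by (subst vector_eq_ldot[symmetric]) (simp only: inner_adjoint_blinfun, simp)
      have "l - l' = adjoint (blinfun_apply (F' u - id_blinfun)) l'"
        using bounded_bilinear.diff_left[OF bounded_bilinear_adjoint, of "F' u" id_blinfun l']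
          l_eq id_eq by simp
      then have "norm (l' - l) \<le> norm (F' u - id_blinfun) * norm l'"
        by (metis norm_adjoint_blinfun_le norm_minus_commute)
      also have "\<dots> \<le> (M * dist u y) * norm l'"
        using lip[of u] u r by (intro mult_right_mono) auto
      finally have 1: "norm (l' - l) \<le> (M * dist u y) * norm l'" .
      \<comment> \<open>The bound above still contains \<open>l'\<close>; the radius \<open>1 / (2 M)\<close> allows it to be absorbed into \<open>l\<close>.\<close>
      have "M * dist u y \<le> M * (1 / (2 * M))"
        using u r M by (intro mult_left_mono) auto
      then have half: "M * dist u y \<le> 1 / 2" using M by simp
      have "norm l' \<le> norm l + norm (l' - l)"
        using norm_triangle_ineq[of l "l' - l"] by simp
      also have "\<dots> \<le> norm l + 1 / 2 * norm l'"
        using 1 mult_right_mono[OF half, of "norm l'"] by simp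
      finally have "norm l' \<le> 2 * norm l" by simp
      then have "(M * dist u y) * norm l' \<le> (M * dist u y) * (2 * norm l)"
        using M by (intro mult_left_mono) auto
      with 1 show ?thesis by simp
    qed
    ultimately show ?thesis by blast
  qed
  then show ?thesis using M r(1) by (intro that[of "2 * M" r]) auto
qed

section \<open>Consequences of metric subregularity\<close>

lemma edist_lessD: "edist z S < ereal c \<Longrightarrow> \<exists>p\<in>S. dist z p < c"
  unfolding edist_def by (auto simp: INF_less_iff)

lemma edist_le_dist: "y \<in> S \<Longrightarrow> edist z S \<le> ereal (dist z y)"
  unfolding edist_def by (rule INF_lower)

text \<open>The truncation to \<open>cball 0 \<delta>\<close> is harmless: for \<open>z\<close> near \<open>x\<close> the projection of \<open>g z\<close> onto \<open>K\<close> is within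
  \<open>\<delta>\<close> of \<open>g z\<close>. Enlarging the constant from \<open>\<kappa>\<close> to \<open>\<kappa> + 1\<close> leaves room to replace an infimum by a point.\<close>

lemma subregular_imp_error_bound:
  fixes g :: "'a::euclidean_space \<Rightarrow> 'b::euclidean_space"
  assumes K: "closed K" "K \<noteq> {}" and cont: "isCont g x"
    and sub: "metrically_subregular (constraint_map g K) x 0"
  obtains \<kappa> r where "\<kappa> \<ge> 0" "r > 0"
    "\<And>z y. dist z x < r \<Longrightarrow> y \<in> K \<Longrightarrow> \<exists>p. g p \<in> K \<and> dist z p \<le> \<kappa> * dist (g z) y"
proof -
  have zero_iff: "0 \<in> constraint_map g K u \<longleftrightarrow> g u \<in> K" for u
    unfolding constraint_map_def by auto
  obtain \<kappa> \<epsilon> \<delta> where \<kappa>: "\<kappa> \<ge> 0" and pos: "\<epsilon> > 0" "\<delta> > 0" and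
    le: "\<And>z. z \<in> cball x \<epsilon> \<Longrightarrow>
      edist z {u. g u \<in> K} \<le> ereal \<kappa> * edist 0 (constraint_map g K z \<inter> cball 0 \<delta>)"
    using sub unfolding metrically_subregular_def zero_iff by blast
  have gx: "g x \<in> K" using sub unfolding metrically_subregular_def zero_iff by blast
  obtain s where s: "s > 0" "\<And>z. dist z x < s \<Longrightarrow> dist (g z) (g x) < \<delta>"
    using cont pos(2) unfolding continuous_at_eps_delta by blast
  have "\<exists>p. g p \<in> K \<and> dist z p \<le> (\<kappa> + 1) * dist (g z) y"
    if z: "dist z x < min \<epsilon> s" and y: "y \<in> K" for z y
  proof (cases "g z \<in> K")
    case True
    then show ?thesis using \<kappa> by (intro exI[of _ z]) simp
  next
    case False
    define y0 where "y0 = closest_point K (g z)"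
    have y0: "y0 \<in> K" unfolding y0_def by (rule closest_point_in_set[OF K])
    have y0_le: "dist (g z) y0 \<le> dist (g z) k" if "k \<in> K" for k
      unfolding y0_def by (rule closest_point_le[OF K(1) that])
    have y0_pos: "dist (g z) y0 > 0" using False y0 by auto
    have "g z - y0 \<in> constraint_map g K z \<inter> cball 0 \<delta>"
    proof
      show "g z - y0 \<in> constraint_map g K z" using y0 unfolding constraint_map_def by blast
      show "g z - y0 \<in> cball 0 \<delta>" using y0_le[OF gx] s(2)[of z] z
        by (simp add: dist_norm norm_minus_commute)
    qed
    then have "edist 0 (constraint_map g K z \<inter> cball 0 \<delta>) \<le> ereal (dist 0 (g z - y0))"
      by (rule edist_le_dist)
    then have "ereal \<kappa> * edist 0 (constraint_map g K z \<inter> cball 0 \<delta>) \<le> ereal \<kappa> * ereal (dist (g z) y0)"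
      using \<kappa> by (intro ereal_mult_left_mono) (auto simp: dist_norm norm_minus_commute)
    then have "edist z {u. g u \<in> K} \<le> ereal (\<kappa> * dist (g z) y0)"
      using le[of z] z by (simp add: dist_commute)
    also have "\<dots> < ereal ((\<kappa> + 1) * dist (g z) y0)"
      using y0_pos by (simp add: distrib_right)
    finally obtain p where p: "g p \<in> K" "dist z p < (\<kappa> + 1) * dist (g z) y0"
      using edist_lessD by blast
    have "(\<kappa> + 1) * dist (g z) y0 \<le> (\<kappa> + 1) * dist (g z) y"
      using \<kappa> y0_le[OF y] by (intro mult_left_mono) auto
    with p show ?thesis by fastforce
  qed
  then show ?thesis
    using \<kappa> pos(1) s(1) by (intro that[of "\<kappa> + 1" "min \<epsilon> s"]) auto
qed

lemma Bseq_convergent_subseq: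
  fixes X :: "nat \<Rightarrow> 'a::euclidean_space"
  assumes "Bseq X"
  obtains l \<sigma> where "strict_mono \<sigma>" "(\<lambda>k. X (\<sigma> k)) \<longlonglongrightarrow> l"
proof -
  obtain B where "\<And>k. norm (X k) \<le> B"
    using assms unfolding Bseq_def by blast
  moreover have "seq_compact (cball (0::'a) B)"
    by (simp add: bounded_closed_imp_seq_compact)
  ultimately show ?thesis
    using that by (auto simp: seq_compact_def o_def)
qed

text \<open>For regular normals this is \<open>regular_normal_multiplier\<close>, whose constant is uniform near \<open>xb\<close>; that
  uniformity bounds the multipliers along a sequence of regular normals and carries the result to
  limiting normals.\<close>

lemma normal_multiplier_bounded:
  fixes g :: "'a::euclidean_space \<Rightarrow> 'b::euclidean_space" and g' :: "'a \<Rightarrow> 'a \<Rightarrow>\<^sub>L 'b"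
  assumes der: "\<And>x. (g has_derivative blinfun_apply (g' x)) (at x)"
    and cont: "\<And>x. isCont g' x"
    and K: "closed K" "convex K" "K \<noteq> {}"
    and sub: "metrically_subregular (constraint_map g K) xb 0"
  obtains \<kappa> r where "\<kappa> \<ge> 0" "r > 0"
    "\<And>x v. dist x xb < r \<Longrightarrow> v \<in> normal_cone (feasible_set g K) x \<Longrightarrow>
      \<exists>l\<in>normal_cone K (g x). v = adjoint (blinfun_apply (g' x)) l \<and> norm l \<le> \<kappa> * norm v"
proof -
  have contg: "isCont g x" for x by (rule has_derivative_continuous[OF der])
  obtain \<kappa> r where \<kappa>: "\<kappa> \<ge> 0" and r: "r > 0" and
    bound: "\<And>z y. dist z xb < r \<Longrightarrow> y \<in> K \<Longrightarrow> \<exists>p. g p \<in> K \<and> dist z p \<le> \<kappa> * dist (g z) y"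
    using subregular_imp_error_bound[OF K(1,3) contg sub] by metis
  have reg: "\<exists>l\<in>normal_cone K (g x). v = adjoint (blinfun_apply (g' x)) l \<and> norm l \<le> \<kappa> * norm v"
    if x: "dist x xb < r" and v: "v \<in> regular_normal_cone (feasible_set g K) x" for x v
  proof (rule regular_normal_multiplier[OF der K(1,2) \<kappa> _ _ v])
    show "r - dist x xb > 0" using x by simp
    show "\<exists>p. g p \<in> K \<and> dist z p \<le> \<kappa> * dist (g z) y" if "dist z x < r - dist x xb" "y \<in> K" for z y
      using that dist_triangle[of z xb x] by (intro bound) auto
  qed
  have "\<exists>l\<in>normal_cone K (g x). v = adjoint (blinfun_apply (g' x)) l \<and> norm l \<le> \<kappa> * norm v"
    if x: "dist x xb < r" and v: "v \<in> normal_cone (feasible_set g K) x" for x v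
  proof -
    obtain xk vk where xk: "\<And>k. xk k \<in> feasible_set g K" "xk \<longlonglongrightarrow> x"
      and vk: "\<And>k. vk k \<in> regular_normal_cone (feasible_set g K) (xk k)" "vk \<longlonglongrightarrow> v"
      using v unfolding normal_cone_def by blast
    have "(\<lambda>k. dist (xk k) xb) \<longlonglongrightarrow> dist x xb" by (intro tendsto_intros xk)
    then have "\<forall>\<^sub>F k in sequentially. dist (xk k) xb < r" using x by (rule order_tendstoD)
    then obtain N where N: "\<And>k. k \<ge> N \<Longrightarrow> dist (xk k) xb < r"
      unfolding eventually_sequentially by blast
    define X where "X = (\<lambda>k. xk (k + N))"
    define V where "V = (\<lambda>k. vk (k + N))"
    have X: "X \<longlonglongrightarrow> x" and V: "V \<longlonglongrightarrow> v"
      unfolding X_def V_def using xk(2) vk(2) by (auto intro: LIMSEQ_ignore_initial_segment)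
    have "\<forall>k. \<exists>l\<in>normal_cone K (g (X k)). V k = adjoint (blinfun_apply (g' (X k))) l \<and>
        norm l \<le> \<kappa> * norm (V k)"
      unfolding X_def V_def using reg N vk(1) by simp
    then obtain l where l: "\<And>k. l k \<in> normal_cone K (g (X k))"
        "\<And>k. V k = adjoint (blinfun_apply (g' (X k))) (l k)" "\<And>k. norm (l k) \<le> \<kappa> * norm (V k)"
      by metis
    have "Bseq (\<lambda>k. \<kappa> * norm (V k))"
      by (rule convergent_imp_Bseq[OF convergentI[OF tendsto_mult[OF tendsto_const tendsto_norm[OF V]]]])
    then have "Bseq l"
      using l(3) by (elim Bseq_eventually_mono[rotated]) (simp add: abs_of_nonneg \<kappa>)
    then obtain l0 \<sigma> where \<sigma>: "strict_mono \<sigma>" and l0: "(\<lambda>k. l (\<sigma> k)) \<longlonglongrightarrow> l0"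
      by (rule Bseq_convergent_subseq)
    have X\<sigma>: "(\<lambda>k. X (\<sigma> k)) \<longlonglongrightarrow> x" and V\<sigma>: "(\<lambda>k. V (\<sigma> k)) \<longlonglongrightarrow> v"
      using LIMSEQ_subseq_LIMSEQ[OF X \<sigma>] LIMSEQ_subseq_LIMSEQ[OF V \<sigma>] by (simp_all add: o_def)
    have gX: "(\<lambda>k. g (X (\<sigma> k))) \<longlonglongrightarrow> g x" by (rule isCont_tendsto_compose[OF contg X\<sigma>])
    have g'X: "(\<lambda>k. g' (X (\<sigma> k))) \<longlonglongrightarrow> g' x" by (rule isCont_tendsto_compose[OF cont X\<sigma>])
    have "l0 \<in> normal_cone K (g x)"
      using l(1) by (intro normal_cone_closed_graph[OF K(1,2) _ gX l0]) simp
    moreover have "v = adjoint (blinfun_apply (g' x)) l0"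
      using LIMSEQ_unique[OF V\<sigma>] bounded_bilinear.tendsto[OF bounded_bilinear_adjoint g'X l0]
      by (simp add: l(2))
    moreover have "norm l0 \<le> \<kappa> * norm v"
      using tendsto_le[OF trivial_limit_sequentially tendsto_mult[OF tendsto_const tendsto_norm[OF V\<sigma>]]
          tendsto_norm[OF l0]] l(3) by simp
    ultimately show ?thesis by blast
  qed
  then show ?thesis using that \<kappa> r by blast
qed

section \<open>Isolated calmness of the multipliers\<close>

lemma multipliers_eq:
  assumes "(g has_derivative blinfun_apply A) (at x)"
  shows "multipliers g K x v = {l \<in> normal_cone K (g x). v = adjoint (blinfun_apply A) l}"
  using frechet_derivative_at[OF assms] by (simp add: multipliers_def adj_deriv_def)

text \<open>The set of multipliers is convex, so if it had a second element, a short segment towards it would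
  meet every ball around \<open>lb\<close> in further multipliers. With \<open>lb\<close> as the only multiplier, the inclusion in
  the definition of calmness becomes an estimate of the distance to \<open>lb\<close>.\<close>

lemma isolated_calm_multipliers:
  fixes g :: "'a::euclidean_space \<Rightarrow> 'b::euclidean_space" and A :: "'a \<Rightarrow>\<^sub>L 'b"
  assumes der: "(g has_derivative blinfun_apply A) (at xb)"
    and K: "closed K" "convex K"
    and calm: "isolated_calm (multipliers g K xb) vb lb"
  obtains \<kappa> \<delta> where "\<kappa> \<ge> 0" "\<delta> > 0" "multipliers g K xb vb = {lb}"
    "\<And>l. l \<in> normal_cone K (g xb) \<Longrightarrow> dist l lb < \<delta> \<Longrightarrow>
       norm (l - lb) \<le> \<kappa> * norm (adjoint (blinfun_apply A) l - vb)"
proof -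
  note M = multipliers_eq[OF der]
  have lb: "lb \<in> multipliers g K xb vb" using calm by (simp add: isolated_calm_def)
  obtain \<kappa> \<epsilon> \<delta> where \<kappa>: "\<kappa> \<ge> 0" and pos: "\<epsilon> > 0" "\<delta> > 0" and
    sub: "\<forall>v\<in>cball vb \<epsilon>. multipliers g K xb v \<inter> cball lb \<delta> \<subseteq>
      {a + (\<kappa> * norm (v - vb)) *\<^sub>R b | a b. a \<in> multipliers g K xb vb \<and> b \<in> cball 0 1}"
    and iso: "multipliers g K xb vb \<inter> cball lb \<delta> = {lb}"
    using calm unfolding isolated_calm_def by blast
  interpret adj: bounded_linear "\<lambda>l. adjoint (blinfun_apply A) l"
    by (rule bounded_bilinear.bounded_linear_right[OF bounded_bilinear_adjoint])
  have single: "l = lb" if l: "l \<in> multipliers g K xb vb" for l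
  proof -
    define s where "s = min 1 (\<delta> / (norm (l - lb) + 1))"
    have den: "norm (l - lb) + 1 > 0" by (simp add: add_nonneg_pos)
    have s: "0 < s" "s \<le> 1" using pos(2) den by (auto simp: s_def)
    have "s * norm (l - lb) \<le> (\<delta> / (norm (l - lb) + 1)) * (norm (l - lb) + 1)"
      using s(1) by (intro mult_mono) (auto simp: s_def)
    then have s\<delta>: "s * norm (l - lb) \<le> \<delta>" using den by simp
    define m where "m = lb + s *\<^sub>R (l - lb)"
    have "m \<bullet> (z - g xb) \<le> 0" if "z \<in> K" for z
    proof -
      have "m \<bullet> (z - g xb) = (1 - s) * (lb \<bullet> (z - g xb)) + s * (l \<bullet> (z - g xb))"
        by (simp add: m_def inner_add_left inner_diff_left algebra_simps)
      also have "\<dots> \<le> 0"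
        using l lb that s by (intro add_nonpos_nonpos mult_nonneg_nonpos)
          (auto simp: M normal_cone_convex[OF K])
      finally show ?thesis .
    qed
    moreover have "adjoint (blinfun_apply A) m = vb"
      using l lb by (simp add: m_def M adj.add adj.scaleR adj.diff)
    ultimately have "m \<in> multipliers g K xb vb"
      using lb by (simp add: M normal_cone_convex[OF K])
    moreover have "m \<in> cball lb \<delta>" using s\<delta> s(1) by (simp add: m_def dist_norm)
    ultimately have "m = lb" using iso by blast
    then show ?thesis using s(1) by (simp add: m_def)
  qed
  then have eq: "multipliers g K xb vb = {lb}" using lb by blast
  have "isCont (\<lambda>l. adjoint (blinfun_apply A) l) lb"
    by (rule linear_continuous_at[OF adj.bounded_linear_axioms])
  moreover have "adjoint (blinfun_apply A) lb = vb" using lb by (simp add: M)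
  ultimately obtain \<rho> where \<rho>: "\<rho> > 0"
    "\<And>l. dist l lb < \<rho> \<Longrightarrow> dist (adjoint (blinfun_apply A) l) vb < \<epsilon>"
    using pos(1) unfolding continuous_at_eps_delta by metis
  have "norm (l - lb) \<le> \<kappa> * norm (adjoint (blinfun_apply A) l - vb)"
    if l: "l \<in> normal_cone K (g xb)" "dist l lb < min \<rho> \<delta>" for l
  proof -
    let ?v = "adjoint (blinfun_apply A) l"
    have "?v \<in> cball vb \<epsilon>" using \<rho>(2)[of l] l(2) by (simp add: dist_commute)
    then have "multipliers g K xb ?v \<inter> cball lb \<delta> \<subseteq>
        {a + (\<kappa> * norm (?v - vb)) *\<^sub>R b | a b. a \<in> multipliers g K xb vb \<and> b \<in> cball 0 1}"
      using sub by blast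
    moreover have "l \<in> multipliers g K xb ?v \<inter> cball lb \<delta>"
      using l by (simp add: M dist_commute)
    ultimately obtain b where b: "l = lb + (\<kappa> * norm (?v - vb)) *\<^sub>R b" "norm b \<le> 1"
      unfolding eq by auto
    have "norm (l - lb) = \<kappa> * norm (?v - vb) * norm b"
      using \<kappa> by (subst b(1)) simp
    also have "\<dots> \<le> \<kappa> * norm (?v - vb)"
      using b(2) \<kappa> by (intro mult_left_le) auto
    finally show ?thesis .
  qed
  then show ?thesis using that[OF \<kappa> _ eq] \<rho>(1) pos(2) by (metis min_less_iff_conj)
qed

lemma hessian_scalarization:
  fixes g :: "'a::euclidean_space \<Rightarrow> 'b::euclidean_space" and g' :: "'a \<Rightarrow> 'a \<Rightarrow>\<^sub>L 'b"
  assumes der: "\<And>x. (g has_derivative blinfun_apply (g' x)) (at x)"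
    and der2: "(g' has_derivative blinfun_apply G) (at xb)"
  shows "hessian (\<lambda>x. l \<bullet> g x) xb d = adjoint (blinfun_apply (blinfun_apply G d)) l"
proof -
  have grad: "gradient (\<lambda>x. l \<bullet> g x) x = adjoint (blinfun_apply (g' x)) l" for x
    unfolding gradient_def
  proof (rule the_equality)
    have "((\<lambda>x. l \<bullet> g x) has_derivative (\<lambda>h. l \<bullet> blinfun_apply (g' x) h)) (at x)"
      by (intro has_derivative_inner_right der)
    then show G: "GDERIV (\<lambda>x. l \<bullet> g x) x :> adjoint (blinfun_apply (g' x)) l"
      by (simp add: gderiv_def inner_adjoint_blinfun inner_commute)
    show "D = adjoint (blinfun_apply (g' x)) l" if "GDERIV (\<lambda>x. l \<bullet> g x) x :> D" for D
      using has_derivative_unique[OF that[unfolded gderiv_def] G[unfolded gderiv_def]]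
      by (metis vector_eq_ldot)
  qed
  have "((\<lambda>x. adjoint (blinfun_apply (g' x)) l) has_derivative
      (\<lambda>h. adjoint (blinfun_apply (blinfun_apply G h)) l)) (at xb)"
    by (rule bounded_linear.has_derivative[OF
      bounded_bilinear.bounded_linear_left[OF bounded_bilinear_adjoint] der2])
  from frechet_derivative_at[OF this] show ?thesis
    unfolding hessian_def grad by metis
qed

section \<open>Tangents to the graph of the normal cone map\<close>

lemma contingent_coneI:
  assumes t: "\<And>k. t k > 0" "t \<longlonglongrightarrow> 0" and w: "wk \<longlonglongrightarrow> w"
    and ev: "\<forall>\<^sub>F k in sequentially. z + t k *\<^sub>R wk k \<in> \<Omega>"
  shows "w \<in> contingent_cone \<Omega> z"
proof -
  obtain N where N: "\<And>k. k \<ge> N \<Longrightarrow> z + t k *\<^sub>R wk k \<in> \<Omega>"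
    using ev unfolding eventually_sequentially by blast
  show ?thesis
    unfolding contingent_cone_def mem_Collect_eq
  proof (intro exI conjI allI)
    show "t (k + N) > 0" for k by (rule t)
    show "(\<lambda>k. t (k + N)) \<longlonglongrightarrow> 0" by (rule LIMSEQ_ignore_initial_segment[OF t(2)])
    show "(\<lambda>k. wk (k + N)) \<longlonglongrightarrow> w" by (rule LIMSEQ_ignore_initial_segment[OF w])
    show "z + t (k + N) *\<^sub>R wk (k + N) \<in> \<Omega>" for k by (rule N) simp
  qed
qed

lemma adjoint_quotient_tendsto:
  fixes g' :: "'a::euclidean_space \<Rightarrow> 'a \<Rightarrow>\<^sub>L 'b::euclidean_space"
  assumes der2: "(g' has_derivative blinfun_apply G) (at xb)"
    and t: "\<And>k. t k > 0" "t \<longlonglongrightarrow> 0" and dk: "dk \<longlonglongrightarrow> d" and \<eta>k: "\<eta>k \<longlonglongrightarrow> \<eta>"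
  shows "(\<lambda>k. (adjoint (blinfun_apply (g' (xb + t k *\<^sub>R dk k))) (lb + t k *\<^sub>R \<eta>k k)
            - adjoint (blinfun_apply (g' xb)) lb) /\<^sub>R t k)
      \<longlonglongrightarrow> adjoint (blinfun_apply (blinfun_apply G d)) lb + adjoint (blinfun_apply (g' xb)) \<eta>"
proof -
  have 1: "((\<lambda>p. g' (fst p)) has_derivative (\<lambda>h. blinfun_apply G (fst h))) (at (xb, lb))"
    by (rule has_derivative_compose[where f = fst, simplified, OF has_derivative_fst[OF has_derivative_ident]])
      (simp add: der2)
  have 2: "(snd has_derivative snd) (at (xb, lb))"
    by (intro bounded_linear_imp_has_derivative bounded_linear_snd)
  have "((\<lambda>p. adjoint (blinfun_apply (g' (fst p))) (snd p)) has_derivative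
      (\<lambda>h. adjoint (blinfun_apply (g' xb)) (snd h) + adjoint (blinfun_apply (blinfun_apply G (fst h))) lb))
      (at (xb, lb))"
    using bounded_bilinear.FDERIV[OF bounded_bilinear_adjoint 1 2] by simp
  from difference_quotient_tendsto[OF this t tendsto_Pair[OF dk \<eta>k]]
  show ?thesis by (simp add: add.commute)
qed

text \<open>Replace \<open>lk k\<close>, a normal at \<open>g (x k)\<close>, by a nearby normal \<open>l'\<close> at \<open>g xb\<close>; calmness bounds \<open>l' - lb\<close> by
  the change from \<open>vb\<close> to \<open>A\<^bsub>xb\<^esub> l'\<close>. That change splits into the effect of replacing \<open>lk k\<close> by \<open>l'\<close>,
  of moving the base point from \<open>x k\<close> to \<open>xb\<close>, and \<open>t k *\<^sub>R wk k\<close>. All three are \<open>O(t k)\<close>.\<close>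

lemma multiplier_linear_rate:
  fixes g :: "'a::euclidean_space \<Rightarrow> 'b::euclidean_space" and g' :: "'a \<Rightarrow> 'a \<Rightarrow>\<^sub>L 'b"
  assumes der: "\<And>x. (g has_derivative blinfun_apply (g' x)) (at x)"
    and der2: "(g' has_derivative blinfun_apply G) (at xb)"
    and K: "closed K" "convex K" and red: "C2_cone_reducible K"
    and calm: "isolated_calm (multipliers g K xb) vb lb"
    and t: "\<And>k. t k > 0" "t \<longlonglongrightarrow> 0" and dk: "dk \<longlonglongrightarrow> d" and wk: "wk \<longlonglongrightarrow> w"
    and lk: "lk \<longlonglongrightarrow> lb"
    and ev: "\<forall>\<^sub>F k in sequentially. lk k \<in> normal_cone K (g (xb + t k *\<^sub>R dk k)) \<and>
        vb + t k *\<^sub>R wk k = adjoint (blinfun_apply (g' (xb + t k *\<^sub>R dk k))) (lk k)"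
  shows "Bseq (\<lambda>k. (lk k - lb) /\<^sub>R t k)"
proof -
  define x where "x = (\<lambda>k. xb + t k *\<^sub>R dk k)"
  have "g xb \<in> K"
    using calm by (simp add: isolated_calm_def multipliers_def normal_cone_convex[OF K])
  then obtain L r where L: "L \<ge> 0" and r: "r > 0" and
    Lr: "\<And>u l. dist u (g xb) < r \<Longrightarrow> l \<in> normal_cone K u \<Longrightarrow>
       \<exists>l'\<in>normal_cone K (g xb). norm (l' - l) \<le> L * dist u (g xb) * norm l"
    using cone_reducible_normal_cone_calm[OF K red] by metis
  obtain \<kappa> \<delta> where \<kappa>: "\<kappa> \<ge> 0" and \<delta>: "\<delta> > 0" and
    calm': "\<And>l. l \<in> normal_cone K (g xb) \<Longrightarrow> dist l lb < \<delta> \<Longrightarrow>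
       norm (l - lb) \<le> \<kappa> * norm (adjoint (blinfun_apply (g' xb)) l - vb)"
    using isolated_calm_multipliers[OF der K calm] by metis
  define E where "E = (\<lambda>k. norm ((g (x k) - g xb) /\<^sub>R t k))"
  define F where "F = (\<lambda>k. norm ((g' (x k) - g' xb) /\<^sub>R t k))"
  have E: "E \<longlonglongrightarrow> norm (blinfun_apply (g' xb) d)"
    unfolding E_def x_def by (intro tendsto_norm difference_quotient_tendsto[OF der t dk])
  have F: "F \<longlonglongrightarrow> norm (blinfun_apply G d)"
    unfolding F_def x_def by (intro tendsto_norm difference_quotient_tendsto[OF der2 t dk])
  have gE: "dist (g (x k)) (g xb) = t k * E k" and gF: "norm (g' (x k) - g' xb) = t k * F k" for k
    using t(1)[of k] by (simp_all add: E_def F_def dist_norm)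
  define P where "P = (\<lambda>k. L * E k * norm (lk k))"
  have P: "P \<longlonglongrightarrow> L * norm (blinfun_apply (g' xb) d) * norm lb"
    unfolding P_def by (intro tendsto_intros E lk)
  define Q where "Q = (\<lambda>k. norm (g' xb) * P k + F k * norm (lk k) + norm (wk k))"
  have Q: "Q \<longlonglongrightarrow> norm (g' xb) * (L * norm (blinfun_apply (g' xb) d) * norm lb)
      + norm (blinfun_apply G d) * norm lb + norm w"
    unfolding Q_def by (intro tendsto_intros P F lk wk)
  have "(\<lambda>k. t k * E k) \<longlonglongrightarrow> 0 * norm (blinfun_apply (g' xb) d)"
    by (intro tendsto_intros E t)
  then have ev1: "\<forall>\<^sub>F k in sequentially. t k * E k < r"
    using r by (intro order_tendstoD(2)) auto
  have "(\<lambda>k. t k * P k + norm (lk k - lb)) \<longlonglongrightarrow>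
      0 * (L * norm (blinfun_apply (g' xb) d) * norm lb) + norm (lb - lb)"
    by (intro tendsto_intros P t lk)
  then have ev2: "\<forall>\<^sub>F k in sequentially. t k * P k + norm (lk k - lb) < \<delta>"
    using \<delta> by (intro order_tendstoD(2)) auto
  from ev ev1 ev2 have "\<forall>\<^sub>F k in sequentially. norm ((lk k - lb) /\<^sub>R t k) \<le> norm (P k + \<kappa> * Q k)"
  proof eventually_elim
    case (elim k)
    have tk: "t k > 0" by (rule t)
    have near: "dist (g (x k)) (g xb) < r" using elim(2) by (simp add: gE)
    have mem: "lk k \<in> normal_cone K (g (x k))"
      and v_eq: "vb + t k *\<^sub>R wk k = adjoint (blinfun_apply (g' (x k))) (lk k)"
      using elim(1) by (simp_all add: x_def)
    obtain l' where l': "l' \<in> normal_cone K (g xb)"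
        "norm (l' - lk k) \<le> L * dist (g (x k)) (g xb) * norm (lk k)"
      using Lr[OF near mem] by blast
    then have l'P: "norm (l' - lk k) \<le> t k * P k"
      by (simp add: gE P_def mult_ac)
    have "dist l' lb \<le> norm (l' - lk k) + norm (lk k - lb)"
      using norm_triangle_ineq[of "l' - lk k" "lk k - lb"] by (simp add: dist_norm)
    then have "dist l' lb < \<delta>" using l'P elim(3) by linarith
    then have c: "norm (l' - lb) \<le> \<kappa> * norm (adjoint (blinfun_apply (g' xb)) l' - vb)"
      by (rule calm'[OF l'(1)])
    have "adjoint (blinfun_apply (g' xb)) l' - vb =
        adjoint (blinfun_apply (g' xb)) (l' - lk k) - adjoint (blinfun_apply (g' (x k) - g' xb)) (lk k)
        + t k *\<^sub>R wk k"
      using v_eq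
      by (simp add: bounded_bilinear.diff_left[OF bounded_bilinear_adjoint]
          bounded_bilinear.diff_right[OF bounded_bilinear_adjoint] algebra_simps)
    also have "norm \<dots> \<le> norm (adjoint (blinfun_apply (g' xb)) (l' - lk k))
        + norm (adjoint (blinfun_apply (g' (x k) - g' xb)) (lk k)) + norm (t k *\<^sub>R wk k)"
      by (intro norm_triangle_mono norm_triangle_ineq4 order_refl)
    also have "\<dots> \<le> norm (g' xb) * (t k * P k) + (t k * F k) * norm (lk k) + t k * norm (wk k)"
    proof (intro add_mono)
      show "norm (adjoint (blinfun_apply (g' xb)) (l' - lk k)) \<le> norm (g' xb) * (t k * P k)"
        using norm_adjoint_blinfun_le l'P by (meson mult_left_mono norm_ge_zero order_trans)
      show "norm (adjoint (blinfun_apply (g' (x k) - g' xb)) (lk k)) \<le> (t k * F k) * norm (lk k)"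
        using norm_adjoint_blinfun_le[of "g' (x k) - g' xb" "lk k"] by (simp add: gF)
    qed (use tk in simp)
    also have "\<dots> = t k * Q k" by (simp add: Q_def algebra_simps)
    finally have "\<kappa> * norm (adjoint (blinfun_apply (g' xb)) l' - vb) \<le> \<kappa> * (t k * Q k)"
      using \<kappa> by (rule mult_left_mono)
    moreover have "norm (lk k - lb) \<le> norm (l' - lk k) + norm (l' - lb)"
      using norm_triangle_ineq4[of "l' - lb" "l' - lk k"] by simp
    ultimately have "norm (lk k - lb) \<le> t k * (P k + \<kappa> * Q k)"
      using c l'P by (simp add: algebra_simps)
    then have "norm (lk k - lb) / t k \<le> P k + \<kappa> * Q k"
      using tk by (simp add: pos_divide_le_eq mult.commute)
    moreover have "norm ((lk k - lb) /\<^sub>R t k) = norm (lk k - lb) / t k"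
      using tk by (simp add: divide_inverse mult.commute)
    ultimately have "norm ((lk k - lb) /\<^sub>R t k) \<le> P k + \<kappa> * Q k" by simp
    then show ?case by simp
  qed
  moreover have "Bseq (\<lambda>k. P k + \<kappa> * Q k)"
    by (rule convergent_imp_Bseq[OF convergentI[OF tendsto_add[OF P tendsto_mult[OF tendsto_const Q]]]])
  ultimately show ?thesis by (rule Bseq_eventually_mono)
qed

lemma tangent_to_normal_graph_imp:
  fixes g :: "'a::euclidean_space \<Rightarrow> 'b::euclidean_space" and g' :: "'a \<Rightarrow> 'a \<Rightarrow>\<^sub>L 'b"
    and G :: "'a \<Rightarrow> 'a \<Rightarrow>\<^sub>L ('a \<Rightarrow>\<^sub>L 'b)"
  assumes der: "\<And>x. (g has_derivative blinfun_apply (g' x)) (at x)"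
    and der2: "\<And>x. (g' has_derivative blinfun_apply (G x)) (at x)"
    and K: "closed K" "convex K" "K \<noteq> {}" and red: "C2_cone_reducible K"
    and sub: "metrically_subregular (constraint_map g K) xb 0"
    and calm: "isolated_calm (multipliers g K xb) vb lb"
    and dw: "(d, w) \<in> contingent_cone (gph (normal_cone (feasible_set g K))) (xb, vb)"
  shows "\<exists>\<eta>\<in>graphical_derivative (normal_cone K) (g xb) lb (blinfun_apply (g' xb) d).
      w = adjoint (blinfun_apply (blinfun_apply (G xb) d)) lb + adjoint (blinfun_apply (g' xb)) \<eta>"
proof -
  have contg: "isCont g x" and contg': "isCont g' x" for x
    by (rule has_derivative_continuous[OF der], rule has_derivative_continuous[OF der2])
  obtain t0 p where t0: "\<And>k. t0 k > 0" "t0 \<longlonglongrightarrow> 0" and p: "p \<longlonglongrightarrow> (d, w)"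
    and mem: "\<And>k. (xb, vb) + t0 k *\<^sub>R p k \<in> gph (normal_cone (feasible_set g K))"
    using dw unfolding contingent_cone_def by auto
  define d0 where "d0 = (\<lambda>k. fst (p k))"
  define w0 where "w0 = (\<lambda>k. snd (p k))"
  have d0: "d0 \<longlonglongrightarrow> d" and w0: "w0 \<longlonglongrightarrow> w"
    unfolding d0_def w0_def using tendsto_fst[OF p] tendsto_snd[OF p] by auto
  have v0: "vb + t0 k *\<^sub>R w0 k \<in> normal_cone (feasible_set g K) (xb + t0 k *\<^sub>R d0 k)" for k
    using mem[of k] by (cases "p k") (simp add: gph_def d0_def w0_def)
  obtain \<kappa> r where \<kappa>: "\<kappa> \<ge> 0" and r: "r > 0" and
    mult: "\<And>x v. dist x xb < r \<Longrightarrow> v \<in> normal_cone (feasible_set g K) x \<Longrightarrow>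
      \<exists>l\<in>normal_cone K (g x). v = adjoint (blinfun_apply (g' x)) l \<and> norm l \<le> \<kappa> * norm v"
    using normal_multiplier_bounded[OF der contg' K sub] by metis
  have x0: "(\<lambda>k. xb + t0 k *\<^sub>R d0 k) \<longlonglongrightarrow> xb" and v0_lim: "(\<lambda>k. vb + t0 k *\<^sub>R w0 k) \<longlonglongrightarrow> vb"
    using tendsto_add[OF tendsto_const tendsto_scaleR[OF t0(2) d0]]
      tendsto_add[OF tendsto_const tendsto_scaleR[OF t0(2) w0]] by auto
  define ok where "ok = (\<lambda>k l. l \<in> normal_cone K (g (xb + t0 k *\<^sub>R d0 k)) \<and>
      vb + t0 k *\<^sub>R w0 k = adjoint (blinfun_apply (g' (xb + t0 k *\<^sub>R d0 k))) l \<and>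
      norm l \<le> \<kappa> * norm (vb + t0 k *\<^sub>R w0 k))"
  \<comment> \<open>Multipliers exist only once \<open>xb + t0 k *\<^sub>R d0 k\<close> is close to \<open>xb\<close>; earlier entries are arbitrary.\<close>
  define l0 where "l0 = (\<lambda>k. SOME l. ok k l)"
  have ok: "\<forall>\<^sub>F k in sequentially. ok k (l0 k)"
    using tendstoD[OF x0 r]
  proof eventually_elim
    case (elim k)
    then have "\<exists>l. ok k l" using mult[OF elim v0] unfolding ok_def by blast
    then show ?case unfolding l0_def by (rule someI_ex)
  qed
  have bs: "Bseq (\<lambda>k. \<kappa> * norm (vb + t0 k *\<^sub>R w0 k))"
    by (rule convergent_imp_Bseq[OF convergentI[OF tendsto_mult[OF tendsto_const tendsto_norm[OF v0_lim]]]])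
  have "\<forall>\<^sub>F k in sequentially. norm (l0 k) \<le> norm (\<kappa> * norm (vb + t0 k *\<^sub>R w0 k))"
    using ok
  proof eventually_elim
    case (elim k)
    then have "norm (l0 k) \<le> \<kappa> * norm (vb + t0 k *\<^sub>R w0 k)" unfolding ok_def by blast
    also have "\<dots> \<le> norm (\<kappa> * norm (vb + t0 k *\<^sub>R w0 k))" unfolding real_norm_def by (rule abs_ge_self)
    finally show ?case .
  qed
  from Bseq_eventually_mono[OF this bs] obtain lim \<sigma> where \<sigma>: "strict_mono \<sigma>" and lim: "(\<lambda>k. l0 (\<sigma> k)) \<longlonglongrightarrow> lim"
    by (rule Bseq_convergent_subseq)
  note sub\<sigma> = LIMSEQ_subseq_LIMSEQ[OF _ \<sigma>, unfolded o_def]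
  have ok\<sigma>: "\<forall>\<^sub>F k in sequentially. ok (\<sigma> k) (l0 (\<sigma> k))" by (rule eventually_subseq[OF \<sigma> ok])
  have "lim \<in> normal_cone K (g xb)"
    by (rule normal_cone_closed_graph[OF K(1,2) _ sub\<sigma>[OF isCont_tendsto_compose[OF contg x0]] lim])
      (rule eventually_mono[OF ok\<sigma>], simp add: ok_def)
  moreover have "adjoint (blinfun_apply (g' xb)) lim = vb"
  proof (rule LIMSEQ_unique)
    show "(\<lambda>k. vb + t0 (\<sigma> k) *\<^sub>R w0 (\<sigma> k)) \<longlonglongrightarrow> vb" by (rule sub\<sigma>[OF v0_lim])
    have "(\<lambda>k. adjoint (blinfun_apply (g' (xb + t0 (\<sigma> k) *\<^sub>R d0 (\<sigma> k)))) (l0 (\<sigma> k)))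
        \<longlonglongrightarrow> adjoint (blinfun_apply (g' xb)) lim"
      by (rule bounded_bilinear.tendsto[OF bounded_bilinear_adjoint
            sub\<sigma>[OF isCont_tendsto_compose[OF contg' x0]] lim])
    then show "(\<lambda>k. vb + t0 (\<sigma> k) *\<^sub>R w0 (\<sigma> k)) \<longlonglongrightarrow> adjoint (blinfun_apply (g' xb)) lim"
      by (rule Lim_transform_eventually) (rule eventually_mono[OF ok\<sigma>], simp add: ok_def)
  qed
  ultimately have "lim \<in> multipliers g K xb vb" by (simp add: multipliers_eq[OF der])
  then have "lim = lb" using isolated_calm_multipliers[OF der K(1,2) calm] by (metis singletonD)
  with lim have l0_lim: "(\<lambda>k. l0 (\<sigma> k)) \<longlonglongrightarrow> lb" by simp
  have "Bseq (\<lambda>k. (l0 (\<sigma> k) - lb) /\<^sub>R t0 (\<sigma> k))"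
    by (rule multiplier_linear_rate[OF der der2 K(1,2) red calm t0(1) sub\<sigma>[OF t0(2)]
          sub\<sigma>[OF d0] sub\<sigma>[OF w0] l0_lim])
      (rule eventually_mono[OF ok\<sigma>], simp add: ok_def)
  then obtain \<eta> \<tau> where \<tau>: "strict_mono \<tau>"
    and \<eta>: "(\<lambda>k. (l0 (\<sigma> (\<tau> k)) - lb) /\<^sub>R t0 (\<sigma> (\<tau> k))) \<longlonglongrightarrow> \<eta>"
    by (rule Bseq_convergent_subseq)
  note sub\<tau> = LIMSEQ_subseq_LIMSEQ[OF sub\<sigma> \<tau>, unfolded o_def]
  have ok\<tau>: "\<forall>\<^sub>F k in sequentially. ok (\<sigma> (\<tau> k)) (l0 (\<sigma> (\<tau> k)))" by (rule eventually_subseq[OF \<tau> ok\<sigma>])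
  define t where "t = (\<lambda>k. t0 (\<sigma> (\<tau> k)))"
  define dk where "dk = (\<lambda>k. d0 (\<sigma> (\<tau> k)))"
  define wk where "wk = (\<lambda>k. w0 (\<sigma> (\<tau> k)))"
  define \<eta>k where "\<eta>k = (\<lambda>k. (l0 (\<sigma> (\<tau> k)) - lb) /\<^sub>R t0 (\<sigma> (\<tau> k)))"
  have t: "\<And>k. t k > 0" "t \<longlonglongrightarrow> 0" and dk: "dk \<longlonglongrightarrow> d" and wk: "wk \<longlonglongrightarrow> w" and \<eta>k: "\<eta>k \<longlonglongrightarrow> \<eta>"
    unfolding t_def dk_def wk_def \<eta>k_def using t0 sub\<tau>[OF t0(2)] sub\<tau>[OF d0] sub\<tau>[OF w0] \<eta> by auto
  have l0_eq: "l0 (\<sigma> (\<tau> k)) = lb + t k *\<^sub>R \<eta>k k" for k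
    using t(1)[of k] by (simp add: \<eta>k_def t_def)
  have ok': "\<forall>\<^sub>F k in sequentially. lb + t k *\<^sub>R \<eta>k k \<in> normal_cone K (g (xb + t k *\<^sub>R dk k)) \<and>
      vb + t k *\<^sub>R wk k = adjoint (blinfun_apply (g' (xb + t k *\<^sub>R dk k))) (lb + t k *\<^sub>R \<eta>k k)"
    unfolding l0_eq[symmetric] unfolding t_def dk_def wk_def
    using ok\<tau> by eventually_elim (simp add: ok_def)
  have "(blinfun_apply (g' xb) d, \<eta>) \<in> contingent_cone (gph (normal_cone K)) (g xb, lb)"
  proof (rule contingent_coneI[OF t])
    show "(\<lambda>k. ((g (xb + t k *\<^sub>R dk k) - g xb) /\<^sub>R t k, \<eta>k k)) \<longlonglongrightarrow> (blinfun_apply (g' xb) d, \<eta>)"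
      by (intro tendsto_Pair difference_quotient_tendsto[OF der t dk] \<eta>k)
    show "\<forall>\<^sub>F k in sequentially. (g xb, lb) + t k *\<^sub>R ((g (xb + t k *\<^sub>R dk k) - g xb) /\<^sub>R t k, \<eta>k k)
        \<in> gph (normal_cone K)"
      using ok'
    proof eventually_elim
      case (elim k)
      then show ?case using t(1)[of k] by (simp add: gph_def)
    qed
  qed
  moreover have "w = adjoint (blinfun_apply (blinfun_apply (G xb) d)) lb + adjoint (blinfun_apply (g' xb)) \<eta>"
  proof (rule LIMSEQ_unique[OF wk])
    have vb: "adjoint (blinfun_apply (g' xb)) lb = vb"
      using calm by (simp add: isolated_calm_def multipliers_eq[OF der])
    show "wk \<longlonglongrightarrow> adjoint (blinfun_apply (blinfun_apply (G xb) d)) lb + adjoint (blinfun_apply (g' xb)) \<eta>"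
    proof (rule Lim_transform_eventually[OF adjoint_quotient_tendsto[OF der2 t dk \<eta>k]])
      show "\<forall>\<^sub>F k in sequentially. (adjoint (blinfun_apply (g' (xb + t k *\<^sub>R dk k))) (lb + t k *\<^sub>R \<eta>k k)
          - adjoint (blinfun_apply (g' xb)) lb) /\<^sub>R t k = wk k"
        using ok'
      proof eventually_elim
        case (elim k)
        then have "adjoint (blinfun_apply (g' (xb + t k *\<^sub>R dk k))) (lb + t k *\<^sub>R \<eta>k k) = vb + t k *\<^sub>R wk k"
          by simp
        then show ?case using t(1)[of k] by (simp add: vb)
      qed
    qed
  qed
  ultimately show ?thesis by (auto simp: graphical_derivative_def)
qed

lemma imp_tangent_to_normal_graph:
  fixes g :: "'a::euclidean_space \<Rightarrow> 'b::euclidean_space" and g' :: "'a \<Rightarrow> 'a \<Rightarrow>\<^sub>L 'b"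
    and G :: "'a \<Rightarrow> 'a \<Rightarrow>\<^sub>L ('a \<Rightarrow>\<^sub>L 'b)"
  assumes der: "\<And>x. (g has_derivative blinfun_apply (g' x)) (at x)"
    and der2: "\<And>x. (g' has_derivative blinfun_apply (G x)) (at x)"
    and K: "closed K" "convex K" "K \<noteq> {}"
    and lb: "lb \<in> multipliers g K xb vb"
    and sub: "metrically_subregular (\<lambda>p. {kkt_map g K p}) (xb, lb, vb) 0"
    and \<eta>: "\<eta> \<in> graphical_derivative (normal_cone K) (g xb) lb (blinfun_apply (g' xb) d)"
    and w: "w = adjoint (blinfun_apply (blinfun_apply (G xb) d)) lb + adjoint (blinfun_apply (g' xb)) \<eta>"
  shows "(d, w) \<in> contingent_cone (gph (normal_cone (feasible_set g K))) (xb, vb)"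
proof -
  let ?\<Phi> = "kkt_map g K"
  have \<Phi>: "?\<Phi> (x, l, v) = (- v + adjoint (blinfun_apply (g' x)) l, g x - closest_point K (g x + l))"
    for x l v
    using frechet_derivative_at[OF der[of x]] by (simp add: kkt_map_def adj_deriv_def)
  have vb: "adjoint (blinfun_apply (g' xb)) lb = vb"
    using lb by (simp add: multipliers_eq[OF der])
  obtain t p where t: "\<And>k. t k > 0" "t \<longlonglongrightarrow> 0" and p: "p \<longlonglongrightarrow> (blinfun_apply (g' xb) d, \<eta>)"
    and mem: "\<And>k. (g xb, lb) + t k *\<^sub>R p k \<in> gph (normal_cone K)"
    using \<eta> unfolding graphical_derivative_def contingent_cone_def by auto
  define u where "u = (\<lambda>k. fst (p k))"
  define \<eta>k where "\<eta>k = (\<lambda>k. snd (p k))"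
  have u: "u \<longlonglongrightarrow> blinfun_apply (g' xb) d" and \<eta>k: "\<eta>k \<longlonglongrightarrow> \<eta>"
    unfolding u_def \<eta>k_def using tendsto_fst[OF p] tendsto_snd[OF p] by auto
  have "lb + t k *\<^sub>R \<eta>k k \<in> normal_cone K (g xb + t k *\<^sub>R u k)" for k
    using mem[of k] by (cases "p k") (simp add: gph_def u_def \<eta>k_def)
  then have proj: "closest_point K ((g xb + t k *\<^sub>R u k) + (lb + t k *\<^sub>R \<eta>k k)) = g xb + t k *\<^sub>R u k" for k
    by (simp add: normal_cone_iff_closest_point[OF K])
  define x where "x = (\<lambda>k. xb + t k *\<^sub>R d)"
  define q where "q = (\<lambda>k. (d, \<eta>k k, w))"
  define z where "z = (\<lambda>k. (xb, lb, vb) + t k *\<^sub>R q k)"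
  have z_eq: "z k = (x k, lb + t k *\<^sub>R \<eta>k k, vb + t k *\<^sub>R w)" for k
    by (simp add: z_def q_def x_def)
  define a where "a = (\<lambda>k. (adjoint (blinfun_apply (g' (x k))) (lb + t k *\<^sub>R \<eta>k k) - vb) /\<^sub>R t k)"
  define b where "b = (\<lambda>k. (g (x k) - g xb) /\<^sub>R t k)"
  have a: "a \<longlonglongrightarrow> w"
    using adjoint_quotient_tendsto[OF der2[of xb] t tendsto_const[of d] \<eta>k, of lb]
    by (simp add: a_def x_def vb w)
  have b: "b \<longlonglongrightarrow> blinfun_apply (g' xb) d"
    unfolding b_def x_def by (rule difference_quotient_tendsto[OF der t tendsto_const])
  define e where "e = (\<lambda>k. norm (a k - w) + 2 * norm (b k - u k))"
  have "e \<longlonglongrightarrow> norm (w - w) + 2 * norm (blinfun_apply (g' xb) d - blinfun_apply (g' xb) d)"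
    unfolding e_def by (intro tendsto_intros a b u)
  then have e: "e \<longlonglongrightarrow> 0" by simp
  have \<Phi>_le: "norm (?\<Phi> (z k)) \<le> t k * e k" for k
  proof -
    let ?l = "lb + t k *\<^sub>R \<eta>k k" and ?y = "g xb + t k *\<^sub>R u k"
    have "- (vb + t k *\<^sub>R w) + adjoint (blinfun_apply (g' (x k))) ?l = t k *\<^sub>R (a k - w)"
      using t(1)[of k] by (simp add: a_def scaleR_diff_right)
    then have 1: "norm (- (vb + t k *\<^sub>R w) + adjoint (blinfun_apply (g' (x k))) ?l) = t k * norm (a k - w)"
      using t(1)[of k] by simp
    have "g (x k) - ?y = t k *\<^sub>R (b k - u k)"
      using t(1)[of k] by (simp add: b_def scaleR_diff_right)
    then have gy: "dist (g (x k)) ?y = t k * norm (b k - u k)"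
      using t(1)[of k] by (simp add: dist_norm)
    have "dist ?y (closest_point K (g (x k) + ?l)) \<le> dist (?y + ?l) (g (x k) + ?l)"
      using closest_point_lipschitz[OF K(2,1,3), of "?y + ?l" "g (x k) + ?l"] by (simp add: proj)
    then have "dist ?y (closest_point K (g (x k) + ?l)) \<le> dist (g (x k)) ?y"
      by (simp add: dist_commute)
    then have "dist (g (x k)) (closest_point K (g (x k) + ?l)) \<le> 2 * (t k * norm (b k - u k))"
      using dist_triangle[of "g (x k)" "closest_point K (g (x k) + ?l)" ?y] gy by linarith
    then have 2: "norm (g (x k) - closest_point K (g (x k) + ?l)) \<le> 2 * (t k * norm (b k - u k))"
      by (simp add: dist_norm)
    show ?thesis
      unfolding z_eq \<Phi>
      by (rule order_trans[OF norm_Pair_le]) (use 1 2 in \<open>simp add: e_def algebra_simps\<close>)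
  qed
  obtain \<kappa> \<epsilon> \<delta> where \<kappa>: "\<kappa> \<ge> 0" and pos: "\<epsilon> > 0" "\<delta> > 0" and
    le: "\<forall>z\<in>cball (xb, lb, vb) \<epsilon>.
      edist z {u. 0 \<in> {?\<Phi> u}} \<le> ereal \<kappa> * edist 0 ({?\<Phi> z} \<inter> cball 0 \<delta>)"
    using sub unfolding metrically_subregular_def by blast
  \<comment> \<open>The additional \<open>t k\<close> makes the bound strict, so that a zero of \<open>\<Phi>\<close> attains it; it is still \<open>o(t k)\<close>.\<close>
  define near where "near = (\<lambda>k s. ?\<Phi> s = 0 \<and> dist (z k) s < t k * (\<kappa> * e k + t k))"
  define s where "s = (\<lambda>k. SOME s. near k s)"
  have q: "q \<longlonglongrightarrow> (d, \<eta>, w)" unfolding q_def by (intro tendsto_intros \<eta>k)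
  have "z \<longlonglongrightarrow> (xb, lb, vb) + 0 *\<^sub>R (d, \<eta>, w)"
    unfolding z_def by (intro tendsto_intros t q)
  then have z: "z \<longlonglongrightarrow> (xb, lb, vb)" by (simp add: zero_prod_def)
  have "(\<lambda>k. t k * e k) \<longlonglongrightarrow> 0" using tendsto_mult[OF t(2) e] by simp
  then have "\<forall>\<^sub>F k in sequentially. t k * e k < \<delta>" using pos(2) by (rule order_tendstoD)
  with tendstoD[OF z pos(1)] have near: "\<forall>\<^sub>F k in sequentially. near k (s k)"
  proof eventually_elim
    case (elim k)
    have "edist 0 ({?\<Phi> (z k)} \<inter> cball 0 \<delta>) \<le> ereal (dist 0 (?\<Phi> (z k)))"
      using \<Phi>_le[of k] elim(2) by (intro edist_le_dist) simp
    also have "\<dots> \<le> ereal (t k * e k)" using \<Phi>_le[of k] by simp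
    finally have "ereal \<kappa> * edist 0 ({?\<Phi> (z k)} \<inter> cball 0 \<delta>) \<le> ereal \<kappa> * ereal (t k * e k)"
      using \<kappa> by (intro ereal_mult_left_mono) auto
    moreover have "edist (z k) {u. 0 \<in> {?\<Phi> u}} \<le> ereal \<kappa> * edist 0 ({?\<Phi> (z k)} \<inter> cball 0 \<delta>)"
      using le elim(1) by (simp add: dist_commute)
    ultimately have "edist (z k) {u. 0 \<in> {?\<Phi> u}} \<le> ereal (\<kappa> * (t k * e k))" by simp
    also have "\<dots> < ereal (t k * (\<kappa> * e k + t k))"
      using t(1)[of k] by (simp add: algebra_simps)
    finally have "\<exists>s. near k s"
      using edist_lessD unfolding near_def by fastforce
    then show ?case unfolding s_def by (rule someI_ex)
  qed
  define c where "c = (\<lambda>k. (s k - z k) /\<^sub>R t k)"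
  have c: "c \<longlonglongrightarrow> 0"
  proof (rule Lim_null_comparison)
    show "\<forall>\<^sub>F k in sequentially. norm (c k) \<le> \<kappa> * e k + t k"
      using near
    proof eventually_elim
      case (elim k)
      then have "norm (s k - z k) \<le> t k * (\<kappa> * e k + t k)"
        by (simp add: near_def dist_norm norm_minus_commute)
      then have "norm (s k - z k) / t k \<le> \<kappa> * e k + t k"
        using t(1)[of k] by (simp add: pos_divide_le_eq mult.commute)
      moreover have "norm (c k) = norm (s k - z k) / t k"
        using t(1)[of k] by (simp add: c_def divide_inverse mult.commute)
      ultimately show ?case by simp
    qed
    show "(\<lambda>k. \<kappa> * e k + t k) \<longlonglongrightarrow> 0"
      using tendsto_add[OF tendsto_mult[OF tendsto_const e] t(2)] by simp
  qed
  have qc: "(\<lambda>k. q k + c k) \<longlonglongrightarrow> (d, \<eta>, w)"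
    using tendsto_add[OF q c] by simp
  have s_eq: "s k = (xb, lb, vb) + t k *\<^sub>R (q k + c k)" for k
    using t(1)[of k] by (simp add: c_def z_def scaleR_add_right)
  show ?thesis
  proof (rule contingent_coneI[OF t])
    show "(\<lambda>k. (fst (q k + c k), snd (snd (q k + c k)))) \<longlonglongrightarrow> (d, w)"
      using tendsto_Pair[OF tendsto_fst[OF qc] tendsto_snd[OF tendsto_snd[OF qc]]] by simp
    show "\<forall>\<^sub>F k in sequentially. (xb, vb) + t k *\<^sub>R (fst (q k + c k), snd (snd (q k + c k)))
        \<in> gph (normal_cone (feasible_set g K))"
      using near
    proof eventually_elim
      case (elim k)
      obtain x' l' v' where s': "s k = (x', l', v')" by (cases "s k")
      have v': "v' = adjoint (blinfun_apply (g' x')) l'" and y': "closest_point K (g x' + l') = g x'"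
        using elim unfolding near_def s' \<Phi> by (auto simp: zero_prod_def)
      have "l' \<in> normal_cone K (g x')"
        using y' by (simp add: normal_cone_iff_closest_point[OF K])
      then have "v' \<in> normal_cone (feasible_set g K) x'"
        unfolding v'
        by (rule regular_normal_imp_normal[OF adjoint_normal_imp_regular_normal[OF der K(1,2)]])
      moreover have "(xb, vb) + t k *\<^sub>R (fst (q k + c k), snd (snd (q k + c k))) = (x', v')"
        using s_eq[of k] unfolding s' by (cases "q k + c k") simp
      ultimately show ?case by (simp add: gph_def)
    qed
  qed
qed

theorem theorem3p1:
  fixes g :: "'a::euclidean_space \<Rightarrow> 'b::euclidean_space"
    and K :: "'b set"
    and xb vb :: 'a
    and lb :: 'b
  assumes "twice_cont_diff_on UNIV g"
    and "K \<noteq> {}" and "closed K" and "convex K" and "C2_cone_reducible K"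
    and "(xb, vb) \<in> gph (normal_cone (feasible_set g K))"
    and "metrically_subregular (constraint_map g K) xb 0"
    and "lb \<in> multipliers g K xb vb"
    and "isolated_calm (multipliers g K xb) vb lb"
  shows "contingent_cone (gph (normal_cone (feasible_set g K))) (xb, vb)
           \<subseteq> {(d, w). w \<in> {hessian (\<lambda>x. lb \<bullet> g x) xb d + adj_deriv g xb \<eta> | \<eta>.
                 \<eta> \<in> graphical_derivative (normal_cone K) (g xb) lb
                        (frechet_derivative g (at xb) d)}}
       \<and> (metrically_subregular (\<lambda>p. {kkt_map g K p}) (xb, lb, vb) 0 \<longrightarrow>
          contingent_cone (gph (normal_cone (feasible_set g K))) (xb, vb)
           = {(d, w). w \<in> {hessian (\<lambda>x. lb \<bullet> g x) xb d + adj_deriv g xb \<eta> | \<eta>.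
                 \<eta> \<in> graphical_derivative (normal_cone K) (g xb) lb
                        (frechet_derivative g (at xb) d)}})"
proof -
  obtain g' G where der: "\<And>x. (g has_derivative blinfun_apply (g' x)) (at x)"
    and der2: "\<And>x. (g' has_derivative blinfun_apply (G x)) (at x)"
    using assms(1) unfolding twice_cont_diff_on_def by blast
  let ?R = "{(d, w). w \<in> {hessian (\<lambda>x. lb \<bullet> g x) xb d + adj_deriv g xb \<eta> | \<eta>.
      \<eta> \<in> graphical_derivative (normal_cone K) (g xb) lb (frechet_derivative g (at xb) d)}}"
  have R: "(d, w) \<in> ?R \<longleftrightarrow>
      (\<exists>\<eta>\<in>graphical_derivative (normal_cone K) (g xb) lb (blinfun_apply (g' xb) d).
        w = adjoint (blinfun_apply (blinfun_apply (G xb) d)) lb + adjoint (blinfun_apply (g' xb)) \<eta>)"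
    for d w
    using frechet_derivative_at[OF der[of xb]] hessian_scalarization[OF der der2]
    by (auto simp: adj_deriv_def)
  have "contingent_cone (gph (normal_cone (feasible_set g K))) (xb, vb) \<subseteq> ?R"
    using tangent_to_normal_graph_imp[OF der der2 assms(3,4,2,5,7,9)]
    by (intro subrelI) (simp only: R)
  moreover have "?R \<subseteq> contingent_cone (gph (normal_cone (feasible_set g K))) (xb, vb)"
    if "metrically_subregular (\<lambda>p. {kkt_map g K p}) (xb, lb, vb) 0"
    using imp_tangent_to_normal_graph[OF der der2 assms(3,4,2,8) that]
    by (intro subrelI) (auto simp only: R)
  ultimately show ?thesis by blast
qed

end
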